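(* Suppose $X=(V,E)$ and $X'=(V',E')$ are simplicial metric graphs that are connected and have uniformly bounded vertex degree. If $X$ and $X'$ are quasi-isometric, then for each $p>1$ the spaces $\mathrm{Wk}^{1,p}(X)$ and $\mathrm{Wk}^{1,p}(X')$ are isomorphic.
   Context: A simplicial metric graph $X=(V,E)$ here is a graph with vertex set $V$ and edge set $E$, with each pair of vertices joined by at most one edge (and no loops), equipped with the path metric obtained by identifying each edge with a copy of the unit interval $[0,1]$. For each edge $e$ one fixes a choice of initial vertex $e_-$ and terminal vertex $e_+$ among its two endpoints. For $u\colon V\to\mathbb{R}$ define $du\colon E\to\mathbb{R}$ by $du(e)=u(e_+)-u(e_-)$. For a countable set $M$ and $p>1$, $\ell^{p,\infty}(M)$ is the space of all $s\colon M\to\mathbb{R}$ for which there is $C\ge0$ with $\#\{m\in M:|s(m)|>\lambda\}\le (C/\lambda)^p$ for all $\lambda>0$, with norm $\|s\|_{\ell^{p,\infty}}=\sup\{n^{-1+1/p}\sum_{j\in F}|s(j)|: n\in\mathbb{N},\ F\subset M,\ \#F=n\}$. $\mathrm{Wk}^{1,p}(X)$ is the quotient vector space $\{u\colon V\to\mathbb{R}: du\in\ell^{p,\infty}(E)\}/(\mathbb{R}+\ell^{p,\infty}(V))$, where $\mathbb{R}$ denotes the constant functions on $V$, with semi-norm $\|u\|_{\mathrm{Wk}^{1,p}}=\inf\{\|du'\|_{\ell^{p,\infty}}:u'\in[u]\}$, where $[u]$ is the class of $u$. Two such semi-normed spaces are isomorphic if there is a linear bijection between them under which the semi-norms are comparable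 (each bounded by a constant times the other). Metric spaces $(X,d_X)$ and $(Y,d_Y)$ are quasi-isometric if there are a map $\varphi\colon X\to Y$ and constants $\lambda\ge1$, $K\ge0$ with $\frac1\lambda d_X(x,x')-K\le d_Y(\varphi(x),\varphi(x'))\le\lambda d_X(x,x')+K$ for all $x,x'\in X$ and $\sup_{y\in Y}\inf_{x\in X}d_Y(y,\varphi(x))\le K$. *)

theory Defs
  imports Complex_Main "HOL-Library.FuncSet" "HOL-Library.Extended_Real"
begin

section \<open>Simplicial metric graphs\<close>

text \<open>
  The edge set is given together with the chosen orientation: an edge \<open>e\<close> is the pair of its
  initial vertex \<open>fst e\<close> and its terminal vertex \<open>snd e\<close>. Asymmetry of the relation excludes both
  loops and two edges with the same endpoints.
\<close>

definition simplicial_graph :: "'v set \<Rightarrow> ('v \<times> 'v) set \<Rightarrow> bool" where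
  "simplicial_graph V E \<longleftrightarrow> E \<subseteq> V \<times> V \<and> asym E"

definition connected_graph :: "'v set \<Rightarrow> ('v \<times> 'v) set \<Rightarrow> bool" where
  "connected_graph V E \<longleftrightarrow> (\<forall>x\<in>V. \<forall>y\<in>V. (x, y) \<in> (E \<union> E\<inverse>)\<^sup>*)"

definition bounded_degree :: "'v set \<Rightarrow> ('v \<times> 'v) set \<Rightarrow> bool" where
  "bounded_degree V E \<longleftrightarrow>
     (\<exists>D::nat. \<forall>v\<in>V. finite {e \<in> E. fst e = v \<or> snd e = v} \<and>
                     card {e \<in> E. fst e = v \<or> snd e = v} \<le> D)"

text \<open>
  Points of the metric graph are vertices, or interior points of edges at a parameter in \<open>(0,1)\<close>.
  The map \<open>edge_point e\<close> identifies \<open>[0,1]\<close> with the closed edge \<open>e\<close>.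
\<close>

datatype 'v graph_point = Vertex 'v | Interior "'v \<times> 'v" real

definition realization :: "'v set \<Rightarrow> ('v \<times> 'v) set \<Rightarrow> 'v graph_point set" where
  "realization V E = Vertex ` V \<union> {Interior e t | e t. e \<in> E \<and> 0 < t \<and> t < 1}"

definition edge_point :: "'v \<times> 'v \<Rightarrow> real \<Rightarrow> 'v graph_point" where
  "edge_point e t =
     (if t = 0 then Vertex (fst e) else if t = 1 then Vertex (snd e) else Interior e t)"

text \<open>
  \<open>piecewise_linear_path E x y l\<close>: there is a path from \<open>x\<close> to \<open>y\<close> of length \<open>l\<close> that is a
  concatenation of finitely many affine segments, each inside one closed edge.
\<close>

inductive piecewise_linear_path ::
  "('v \<times> 'v) set \<Rightarrow> 'v graph_point \<Rightarrow> 'v graph_point \<Rightarrow> real \<Rightarrow> bool" for E where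
  const: "piecewise_linear_path E x x 0"
| segment: "e \<in> E \<Longrightarrow> s \<in> {0..1} \<Longrightarrow> t \<in> {0..1} \<Longrightarrow>
    piecewise_linear_path E (edge_point e t) y l \<Longrightarrow>
    piecewise_linear_path E (edge_point e s) y (\<bar>s - t\<bar> + l)"

definition path_dist ::
  "('v \<times> 'v) set \<Rightarrow> 'v graph_point \<Rightarrow> 'v graph_point \<Rightarrow> real" where
  "path_dist E x y = Inf {l. piecewise_linear_path E x y l}"

section \<open>Quasi-isometry\<close>

text \<open>
  Supremum and infimum are taken in the extended reals, so that the infimum over an empty set
  is \<open>\<infinity>\<close>.
\<close>

definition quasi_isometric ::
  "'a set \<Rightarrow> ('a \<Rightarrow> 'a \<Rightarrow> real) \<Rightarrow> 'b set \<Rightarrow> ('b \<Rightarrow> 'b \<Rightarrow> real) \<Rightarrow> bool" where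
  "quasi_isometric X dX Y dY \<longleftrightarrow>
     (\<exists>\<phi> \<in> X \<rightarrow> Y. \<exists>L K::real. L \<ge> 1 \<and> K \<ge> 0 \<and>
        (\<forall>x\<in>X. \<forall>x'\<in>X. (1 / L) * dX x x' - K \<le> dY (\<phi> x) (\<phi> x') \<and>
                      dY (\<phi> x) (\<phi> x') \<le> L * dX x x' + K) \<and>
        (SUP y\<in>Y. INF x\<in>X. ereal (dY y (\<phi> x))) \<le> ereal K)"

section \<open>Weak Lebesgue sequence spaces\<close>

text \<open>
  Functions on a set \<open>M\<close> are represented by extensional functions, that is, functions with the
  fixed value \<open>undefined\<close> outside \<open>M\<close>.
\<close>

definition weak_lp :: "real \<Rightarrow> 'a set \<Rightarrow> ('a \<Rightarrow> real) set" where
  "weak_lp p M = {s \<in> M \<rightarrow>\<^sub>E UNIV. \<exists>C\<ge>0. \<forall>t>0.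
     finite {m \<in> M. \<bar>s m\<bar> > t} \<and> real (card {m \<in> M. \<bar>s m\<bar> > t}) \<le> (C / t) powr p}"

text \<open>The empty set \<open>F\<close> contributes the value \<open>0\<close>, because \<open>0 powr a = 0\<close>.\<close>

definition weak_lp_norm :: "real \<Rightarrow> 'a set \<Rightarrow> ('a \<Rightarrow> real) \<Rightarrow> real" where
  "weak_lp_norm p M s =
     Sup {real n powr (- 1 + 1 / p) * (\<Sum>j\<in>F. \<bar>s j\<bar>) | n F. finite F \<and> F \<subseteq> M \<and> card F = n}"

section \<open>Semi-normed spaces\<close>

record 'a seminormed_space =
  sn_carrier :: "'a set"
  sn_add :: "'a \<Rightarrow> 'a \<Rightarrow> 'a"
  sn_scale :: "real \<Rightarrow> 'a \<Rightarrow> 'a"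
  sn_norm :: "'a \<Rightarrow> real"

definition seminormed_isomorphic :: "'a seminormed_space \<Rightarrow> 'b seminormed_space \<Rightarrow> bool" where
  "seminormed_isomorphic S S' \<longleftrightarrow>
     (\<exists>T. bij_betw T (sn_carrier S) (sn_carrier S') \<and>
        (\<forall>a\<in>sn_carrier S. \<forall>b\<in>sn_carrier S. T (sn_add S a b) = sn_add S' (T a) (T b)) \<and>
        (\<forall>c. \<forall>a\<in>sn_carrier S. T (sn_scale S c a) = sn_scale S' c (T a)) \<and>
        (\<exists>C. \<forall>a\<in>sn_carrier S. sn_norm S' (T a) \<le> C * sn_norm S a) \<and>
        (\<exists>C. \<forall>a\<in>sn_carrier S. sn_norm S a \<le> C * sn_norm S' (T a)))"

section \<open>The space \<open>Wk\<^sup>1\<^sup>,\<^sup>p\<close>\<close>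

definition edge_diff :: "('v \<times> 'v) set \<Rightarrow> ('v \<Rightarrow> real) \<Rightarrow> ('v \<times> 'v) \<Rightarrow> real" where
  "edge_diff E u = (\<lambda>e\<in>E. u (snd e) - u (fst e))"

definition wk_functions :: "real \<Rightarrow> 'v set \<Rightarrow> ('v \<times> 'v) set \<Rightarrow> ('v \<Rightarrow> real) set" where
  "wk_functions p V E = {u \<in> V \<rightarrow>\<^sub>E UNIV. edge_diff E u \<in> weak_lp p E}"

definition wk_null :: "real \<Rightarrow> 'v set \<Rightarrow> ('v \<Rightarrow> real) set" where
  "wk_null p V = {\<lambda>v\<in>V. c + s v | c s. s \<in> weak_lp p V}"

definition wk_class :: "real \<Rightarrow> 'v set \<Rightarrow> ('v \<Rightarrow> real) \<Rightarrow> ('v \<Rightarrow> real) set" where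
  "wk_class p V u = {\<lambda>v\<in>V. u v + n v | n. n \<in> wk_null p V}"

text \<open>
  The quotient space, whose elements are the cosets of \<open>wk_null p V\<close> in \<open>wk_functions p V E\<close>. The
  unions in the operations are over representatives, all of which give the same coset.
\<close>

definition Wk :: "real \<Rightarrow> 'v set \<Rightarrow> ('v \<times> 'v) set \<Rightarrow> ('v \<Rightarrow> real) set seminormed_space" where
  "Wk p V E = \<lparr>
     sn_carrier = wk_class p V ` wk_functions p V E,
     sn_add = (\<lambda>A B. \<Union>u\<in>A. \<Union>w\<in>B. wk_class p V (\<lambda>v\<in>V. u v + w v)),
     sn_scale = (\<lambda>c A. \<Union>u\<in>A. wk_class p V (\<lambda>v\<in>V. c * u v)),
     sn_norm = (\<lambda>A. Inf {weak_lp_norm p E (edge_diff E u) | u. u \<in> A})\<rparr>"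

end

theory Submission
  imports Defs
begin

text \<open>
  A quasi-isometry between the metric graphs, rounded to vertices, gives maps
  \<open>f : V \<rightarrow> V'\<close> and \<open>g : V' \<rightarrow> V\<close> that move neighbouring vertices to vertices at bounded
  combinatorial distance and are inverse to each other up to bounded distance
  (\<open>quasi_isometric_coarse_inverses\<close>). The isomorphism sends the class of \<open>u\<close> to the class of
  \<open>u \<circ> g\<close>, and its inverse sends the class of \<open>w\<close> to the class of \<open>w \<circ> f\<close>.

  Everything about this operator comes from one observation. If \<open>x\<close> and \<open>y\<close> are joined by a path
  of at most \<open>n\<close> edges, then \<open>\<bar>u x - u y\<bar>\<close> is at most \<open>n\<close> times the largest value of \<open>\<bar>du\<bar>\<close> on
  the path, so a single edge near \<open>x\<close> controls the difference (\<open>difference_bounded_by_edge\<close>).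
  Because balls and the fibres of \<open>g\<close> have bounded cardinality, there is a bound on how often an edge is
  used in this way. A sequence that is dominated in this manner by a sequence in
  the weak Lebesgue space is in that space, with norm control (\<open>weak_lp_dominated\<close>,
  \<open>weak_lp_norm_dominated\<close>). Applied to \<open>d(u \<circ> g)\<close>, this bounds the semi-norm of the image; applied to
  \<open>u \<circ> g \<circ> f - u\<close>, it shows that the two operators are inverse modulo sequences in the weak
  Lebesgue space of the vertices; applied to \<open>s \<circ> g\<close>, it shows that the operator respects classes.

  The passage between the metric of the realization and combinatorial distance uses that a
  1-Lipschitz function on the vertices remains 1-Lipschitz when it is extended linearly to the edges.
\<close>

section \<open>Weak Lebesgue sequence spaces\<close>

lemma weak_lp_iff:
  "s \<in> weak_lp p M \<longleftrightarrow> s \<in> extensional M \<and> (\<exists>C\<ge>0. \<forall>t>0.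
     finite {m \<in> M. \<bar>s m\<bar> > t} \<and> real (card {m \<in> M. \<bar>s m\<bar> > t}) \<le> (C / t) powr p)"
  by (auto simp: weak_lp_def PiE_def)

text \<open>
  Telescoping this increment bounds \<open>1 + 2\<^sup>q\<^sup>-\<^sup>1 + \<dots> + n\<^sup>q\<^sup>-\<^sup>1\<close> by \<open>n\<^sup>q / q\<close>.
\<close>

lemma powr_increment_ge:
  fixes q :: real and n :: nat
  assumes "0 < q" "q < 1" "1 \<le> n"
  shows "q * real n powr (q - 1) \<le> real n powr q - real (n - 1) powr q"
proof (cases "n = 1")
  case True
  then show ?thesis using assms by simp
next
  case False
  then have n: "real n - 1 \<ge> 1" using assms by linarith
  \<comment> \<open>The case \<open>n = 1\<close> is separate because the power is not differentiable at 0.\<close>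
  have "\<exists>z. real n - 1 < z \<and> z < real n \<and>
      real n powr q - (real n - 1) powr q = (real n - (real n - 1)) * (q * z powr (q - 1))"
    by (rule MVT2) (use n in \<open>auto intro!: derivative_eq_intros simp: field_simps\<close>)
  then obtain z where z: "real n - 1 < z" "z < real n"
      "real n powr q - (real n - 1) powr q = q * z powr (q - 1)" by auto
  have "real n powr (q - 1) \<le> z powr (q - 1)"
    by (rule powr_mono2') (use z n assms in auto)
  then show ?thesis using z assms by (simp add: of_nat_diff)
qed

text \<open>
  If the entries of \<open>F\<close> are arranged in decreasing order, the level set estimate bounds the \<open>n\<close>-th one
  by \<open>C n\<^sup>-\<^sup>1\<^sup>/\<^sup>p\<close>, and these bounds are summed. The induction removes a smallest entry at each step,
  which avoids an explicit ordering. The condition \<open>p > 1\<close> makes the exponent \<open>1 - 1/p\<close> positive.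
\<close>

lemma sum_weak_lp_le:
  fixes s :: "'a \<Rightarrow> real"
  assumes p: "p > 1" and C: "C \<ge> 0"
    and level: "\<And>t. t > 0 \<Longrightarrow> finite {m \<in> M. \<bar>s m\<bar> > t} \<and>
                     real (card {m \<in> M. \<bar>s m\<bar> > t}) \<le> (C / t) powr p"
    and F: "finite F" "F \<subseteq> M"
  shows "(\<Sum>j\<in>F. \<bar>s j\<bar>) \<le> C / (1 - 1 / p) * real (card F) powr (1 - 1 / p)"
  using F
proof (induction "card F" arbitrary: F)
  case 0
  then show ?case by simp
next
  case (Suc n)
  let ?q = "1 - 1 / p" and ?N = "card F"
  have ne: "F \<noteq> {}" using Suc.hyps(2) by auto
  then obtain m where m: "m \<in> F" "\<And>j. j \<in> F \<Longrightarrow> \<bar>s m\<bar> \<le> \<bar>s j\<bar>"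
    using Suc.prems(1) by (meson arg_min_if_finite(1) arg_min_least)
  have N: "?N \<ge> 1" "n = ?N - 1" using Suc.hyps(2) by auto
  have q: "0 < ?q" "?q < 1" using p by (auto simp: field_simps)
  have small: "\<bar>s m\<bar> \<le> C * real ?N powr (- 1 / p)"
  \<comment> \<open>The level sets are defined by a strict inequality, so the level approaches the minimum from below.\<close>
  proof (rule dense_le)
    fix t assume t: "t < \<bar>s m\<bar>"
    show "t \<le> C * real ?N powr (- 1 / p)"
    proof (cases "t > 0")
      case False
      then show ?thesis using C by (meson mult_nonneg_nonneg not_less order_trans powr_ge_zero)
    next
      case True
      have "F \<subseteq> {m \<in> M. \<bar>s m\<bar> > t}" using m(2) t Suc.prems(2) by force
      then have "real ?N \<le> real (card {m \<in> M. \<bar>s m\<bar> > t})"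
        using level[OF True] by (simp add: card_mono)
      also have "\<dots> \<le> (C / t) powr p" using level[OF True] by simp
      finally have "real ?N powr (1 / p) \<le> ((C / t) powr p) powr (1 / p)"
        using p by (intro powr_mono2) auto
      also have "\<dots> = C / t" using p C True by (simp add: powr_powr)
      finally show ?thesis using True N by (simp add: powr_minus field_simps)
    qed
  qed
  have "(\<Sum>j\<in>F. \<bar>s j\<bar>) = \<bar>s m\<bar> + (\<Sum>j\<in>F - {m}. \<bar>s j\<bar>)"
    using m(1) Suc.prems(1) by (simp add: sum.remove)
  also have "\<dots> \<le> C * real ?N powr (- 1 / p) + C / ?q * real (?N - 1) powr ?q"
  proof (intro add_mono small)
    have "n = card (F - {m})" using m(1) Suc.prems(1) N by simp
    from Suc.hyps(1)[OF this] show "(\<Sum>j\<in>F - {m}. \<bar>s j\<bar>) \<le> C / ?q * real (?N - 1) powr ?q"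
      using Suc.prems m(1) by auto
  qed
  also have "C * real ?N powr (- 1 / p) = C / ?q * (?q * real ?N powr (?q - 1))"
    using q by simp
  also have "\<dots> \<le> C / ?q * (real ?N powr ?q - real (?N - 1) powr ?q)"
    by (intro mult_left_mono powr_increment_ge) (use q C N in auto)
  finally show ?case by (simp add: algebra_simps)
qed

text \<open>
  The norm is a supremum of real numbers, so it is meaningful only with this bound.
\<close>

lemma bdd_above_weak_lp_norm:
  assumes p: "p > 1" and s: "s \<in> weak_lp p M"
  shows "bdd_above {real n powr (- 1 + 1 / p) * (\<Sum>j\<in>F. \<bar>s j\<bar>) | n F.
           finite F \<and> F \<subseteq> M \<and> card F = n}"
proof -
  obtain C where C: "C \<ge> 0" and level: "\<And>t. t > 0 \<Longrightarrow> finite {m \<in> M. \<bar>s m\<bar> > t} \<and>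
                     real (card {m \<in> M. \<bar>s m\<bar> > t}) \<le> (C / t) powr p"
    using s unfolding weak_lp_iff by blast
  have "real (card F) powr (- 1 + 1 / p) * (\<Sum>j\<in>F. \<bar>s j\<bar>) \<le> C / (1 - 1 / p)"
    if "finite F" "F \<subseteq> M" for F
  proof -
    have "real (card F) powr (- 1 + 1 / p) * (\<Sum>j\<in>F. \<bar>s j\<bar>)
        \<le> real (card F) powr (- 1 + 1 / p) * (C / (1 - 1 / p) * real (card F) powr (1 - 1 / p))"
      by (intro mult_left_mono sum_weak_lp_le[OF p C level that]) auto
    also have "\<dots> = C / (1 - 1 / p) * real (card F) powr 0"
      by (simp add: powr_add[symmetric] del: powr_zero_eq_one)
    also have "\<dots> \<le> C / (1 - 1 / p) * 1"
      using p C by (intro mult_left_mono) auto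
    finally show ?thesis by simp
  qed
  then show ?thesis by (intro bdd_aboveI[where M = "C / (1 - 1 / p)"]) blast
qed

lemma weak_lp_norm_upper:
  assumes "p > 1" "s \<in> weak_lp p M" "finite F" "F \<subseteq> M"
  shows "real (card F) powr (- 1 + 1 / p) * (\<Sum>j\<in>F. \<bar>s j\<bar>) \<le> weak_lp_norm p M s"
  unfolding weak_lp_norm_def
  by (rule cSup_upper[OF _ bdd_above_weak_lp_norm[OF assms(1,2)]]) (use assms in blast)

lemma weak_lp_norm_nonneg:
  assumes "p > 1" "s \<in> weak_lp p M"
  shows "0 \<le> weak_lp_norm p M s"
  using weak_lp_norm_upper[OF assms, of "{}"] by simp

lemma weak_lp_norm_least:
  assumes "\<And>F. finite F \<Longrightarrow> F \<subseteq> M \<Longrightarrow> real (card F) powr (- 1 + 1 / p) * (\<Sum>j\<in>F. \<bar>s j\<bar>) \<le> B"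
  shows "weak_lp_norm p M s \<le> B"
  unfolding weak_lp_norm_def by (rule cSup_least) (use assms in blast)+

text \<open>
  Each index \<open>i\<close> where \<open>t\<close> does not vanish is charged to some \<open>j\<close> related to it, and each \<open>j\<close> is
  charged at most \<open>N\<close> times. A level set of \<open>t\<close> is then covered by the fibres over a level set of \<open>s\<close>.
\<close>

lemma weak_lp_dominated:
  fixes s :: "'a \<Rightarrow> real" and t :: "'b \<Rightarrow> real"
  assumes p: "p > 0" and s: "s \<in> weak_lp p M" and t: "t \<in> extensional M'" and K: "0 \<le> K"
    and dom: "\<And>i. i \<in> M' \<Longrightarrow> t i \<noteq> 0 \<Longrightarrow> \<exists>j\<in>M. R i j \<and> \<bar>t i\<bar> \<le> K * \<bar>s j\<bar>"
    and fib: "\<And>j. j \<in> M \<Longrightarrow> finite {i \<in> M'. R i j} \<and> card {i \<in> M'. R i j} \<le> N"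
  shows "t \<in> weak_lp p M'"
proof -
  obtain C where C: "C \<ge> 0" and level: "\<And>l. l > 0 \<Longrightarrow> finite {m \<in> M. \<bar>s m\<bar> > l} \<and>
                     real (card {m \<in> M. \<bar>s m\<bar> > l}) \<le> (C / l) powr p"
    using s unfolding weak_lp_iff by blast
  \<comment> \<open>The factor \<open>K + 1\<close> instead of \<open>K\<close> permits division by it below; \<open>N powr (1 / p)\<close> absorbs the fibre size.\<close>
  define C' where "C' = real N powr (1 / p) * (C * (K + 1))"
  have "finite {i \<in> M'. \<bar>t i\<bar> > l} \<and> real (card {i \<in> M'. \<bar>t i\<bar> > l}) \<le> (C' / l) powr p"
    if l: "l > 0" for l
  proof -
    let ?S = "{m \<in> M. \<bar>s m\<bar> > l / (K + 1)}"
    let ?U = "\<Union>j\<in>?S. {i \<in> M'. R i j}"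
    have l': "l / (K + 1) > 0" using l K by simp
    note lev = level[OF l']
    have sub: "{i \<in> M'. \<bar>t i\<bar> > l} \<subseteq> ?U"
    proof
      fix i assume "i \<in> {i \<in> M'. \<bar>t i\<bar> > l}"
      then have i: "i \<in> M'" "\<bar>t i\<bar> > l" by auto
      then have "t i \<noteq> 0" using l by auto
      then obtain j where j: "j \<in> M" "R i j" "\<bar>t i\<bar> \<le> K * \<bar>s j\<bar>" using dom[OF i(1)] by blast
      have "l < (K + 1) * \<bar>s j\<bar>" using i(2) j(3) by (simp add: algebra_simps)
      then have "l / (K + 1) < \<bar>s j\<bar>" using K by (simp add: divide_less_eq mult.commute)
      then show "i \<in> ?U" using i j by auto
    qed
    have finU: "finite ?U" using lev fib by blast
    have "card ?U \<le> (\<Sum>j\<in>?S. card {i \<in> M'. R i j})" using lev by (intro card_UN_le) auto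
    also have "\<dots> \<le> card ?S * N" using fib by (intro sum_bounded_above[where K = N, simplified]) auto
    finally have "card {i \<in> M'. \<bar>t i\<bar> > l} \<le> card ?S * N"
      using card_mono[OF finU sub] by linarith
    then have "real (card {i \<in> M'. \<bar>t i\<bar> > l}) \<le> real (card ?S) * real N"
      by (metis of_nat_le_iff of_nat_mult)
    also have "\<dots> \<le> (C / (l / (K + 1))) powr p * real N" using lev by (intro mult_right_mono) auto
    also have "\<dots> = (C' / l) powr p"
    proof -
      have "C' / l = real N powr (1 / p) * (C / (l / (K + 1)))" by (simp add: C'_def)
      then have "(C' / l) powr p = (real N powr (1 / p)) powr p * (C / (l / (K + 1))) powr p"
        using C K l by (simp only:, subst powr_mult) auto
      then show ?thesis using p by (simp add: powr_powr)
    qed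
    finally show ?thesis using finite_subset[OF sub finU] by simp
  qed
  moreover have "C' \<ge> 0" using C K by (simp add: C'_def)
  ultimately show ?thesis using t unfolding weak_lp_iff by blast
qed

text \<open>
  The same charging: a sum of \<open>\<bar>t\<bar>\<close> over \<open>F\<close> is at most \<open>K N\<close> times a sum of \<open>\<bar>s\<bar>\<close> over the set \<open>G\<close>
  of charged indices. As \<open>G\<close> has at most as many elements as \<open>F\<close> and the exponent \<open>-1 + 1/p\<close> is
  negative, the weight of \<open>G\<close> in the norm is at least that of \<open>F\<close>.
\<close>

lemma weak_lp_norm_dominated:
  fixes s :: "'a \<Rightarrow> real" and t :: "'b \<Rightarrow> real"
  assumes p: "p > 1" and s: "s \<in> weak_lp p M" and K: "0 \<le> K"
    and dom: "\<And>i. i \<in> M' \<Longrightarrow> t i \<noteq> 0 \<Longrightarrow> \<exists>j\<in>M. R i j \<and> \<bar>t i\<bar> \<le> K * \<bar>s j\<bar>"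
    and fib: "\<And>j. j \<in> M \<Longrightarrow> finite {i \<in> M'. R i j} \<and> card {i \<in> M'. R i j} \<le> N"
  shows "weak_lp_norm p M' t \<le> K * real N * weak_lp_norm p M s"
proof (rule weak_lp_norm_least)
  fix F assume F: "finite F" "F \<subseteq> M'"
  define F0 where "F0 = {i \<in> F. t i \<noteq> 0}"
  have "\<forall>i\<in>F0. \<exists>j. j \<in> M \<and> R i j \<and> \<bar>t i\<bar> \<le> K * \<bar>s j\<bar>"
    using dom F(2) by (fastforce simp: F0_def)
  then obtain g where g: "\<And>i. i \<in> F0 \<Longrightarrow> g i \<in> M \<and> R i (g i) \<and> \<bar>t i\<bar> \<le> K * \<bar>s (g i)\<bar>"
    by metis
  let ?a = "- 1 + 1 / p" and ?G = "g ` F0"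
  have fin0: "finite F0" "F0 \<subseteq> F" using F by (auto simp: F0_def)
  have "(\<Sum>i\<in>F. \<bar>t i\<bar>) = (\<Sum>i\<in>F0. \<bar>t i\<bar>)"
    by (rule sum.mono_neutral_right) (use F in \<open>auto simp: F0_def\<close>)
  also have "\<dots> \<le> (\<Sum>i\<in>F0. K * \<bar>s (g i)\<bar>)" using g by (intro sum_mono) auto
  also have "\<dots> = (\<Sum>j\<in>?G. \<Sum>i\<in>{i \<in> F0. g i = j}. K * \<bar>s (g i)\<bar>)"
    using fin0(1) by (rule sum.image_gen)
  also have "\<dots> \<le> (\<Sum>j\<in>?G. real N * (K * \<bar>s j\<bar>))"
  proof (rule sum_mono)
    fix j assume j: "j \<in> ?G"
    then have jM: "j \<in> M" using g by auto
    have "{i \<in> F0. g i = j} \<subseteq> {i \<in> M'. R i j}" using g fin0 F by auto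
    then have "card {i \<in> F0. g i = j} \<le> N"
      using fib[OF jM] by (meson card_mono order_trans)
    then have "real (card {i \<in> F0. g i = j}) * (K * \<bar>s j\<bar>) \<le> real N * (K * \<bar>s j\<bar>)"
      using K by (intro mult_right_mono) auto
    then show "(\<Sum>i\<in>{i \<in> F0. g i = j}. K * \<bar>s (g i)\<bar>) \<le> real N * (K * \<bar>s j\<bar>)" by simp
  qed
  finally have sum_le: "(\<Sum>i\<in>F. \<bar>t i\<bar>) \<le> K * real N * (\<Sum>j\<in>?G. \<bar>s j\<bar>)"
    by (simp add: sum_distrib_left mult_ac)
  have pow: "real (card F) powr ?a * (\<Sum>j\<in>?G. \<bar>s j\<bar>) \<le> real (card ?G) powr ?a * (\<Sum>j\<in>?G. \<bar>s j\<bar>)"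
  proof (cases "?G = {}")
    case False
    have "card ?G \<le> card F" using card_image_le[OF fin0(1), of g] card_mono[OF F(1) fin0(2)] by linarith
    moreover have "card ?G > 0" using False fin0 by (simp add: card_gt_0_iff)
    ultimately show ?thesis
      using p by (intro mult_right_mono powr_mono2' sum_nonneg) (auto simp: field_simps)
  qed simp
  have "real (card F) powr ?a * (\<Sum>i\<in>F. \<bar>t i\<bar>) \<le> real (card F) powr ?a * (K * real N * (\<Sum>j\<in>?G. \<bar>s j\<bar>))"
    by (intro mult_left_mono sum_le) auto
  also have "\<dots> = K * real N * (real (card F) powr ?a * (\<Sum>j\<in>?G. \<bar>s j\<bar>))" by (simp add: mult_ac)
  also have "\<dots> \<le> K * real N * (real (card ?G) powr ?a * (\<Sum>j\<in>?G. \<bar>s j\<bar>))"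
    using K by (intro mult_left_mono pow) auto
  also have "\<dots> \<le> K * real N * weak_lp_norm p M s"
    using g fin0 K by (intro mult_left_mono weak_lp_norm_upper[OF p s]) auto
  finally show "real (card F) powr ?a * (\<Sum>i\<in>F. \<bar>t i\<bar>) \<le> K * real N * weak_lp_norm p M s" .
qed

lemma weak_lp_add:
  assumes p: "p > 0" and s: "s \<in> weak_lp p M" and t: "t \<in> weak_lp p M"
  shows "(\<lambda>m\<in>M. s m + t m) \<in> weak_lp p M"
proof -
  obtain C where C: "C \<ge> 0" and levC: "\<And>l. l > 0 \<Longrightarrow> finite {m \<in> M. \<bar>s m\<bar> > l} \<and>
                     real (card {m \<in> M. \<bar>s m\<bar> > l}) \<le> (C / l) powr p"
    using s unfolding weak_lp_iff by blast
  obtain D where D: "D \<ge> 0" and levD: "\<And>l. l > 0 \<Longrightarrow> finite {m \<in> M. \<bar>t m\<bar> > l} \<and>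
                     real (card {m \<in> M. \<bar>t m\<bar> > l}) \<le> (D / l) powr p"
    using t unfolding weak_lp_iff by blast
  \<comment> \<open>One summand exceeds half the level; \<open>2 powr (1 / p)\<close> absorbs the two resulting level sets.\<close>
  define B where "B = 2 powr (1 / p) * (2 * (C + D))"
  have "finite {m \<in> M. \<bar>s m + t m\<bar> > l} \<and> real (card {m \<in> M. \<bar>s m + t m\<bar> > l}) \<le> (B / l) powr p"
    if l: "l > 0" for l
  proof -
    let ?S = "{m \<in> M. \<bar>s m\<bar> > l / 2}" and ?T = "{m \<in> M. \<bar>t m\<bar> > l / 2}"
    have l2: "l / 2 > 0" using l by simp
    have sub: "{m \<in> M. \<bar>s m + t m\<bar> > l} \<subseteq> ?S \<union> ?T" by auto
    have fin: "finite (?S \<union> ?T)" using levC[OF l2] levD[OF l2] by simp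
    have "card {m \<in> M. \<bar>s m + t m\<bar> > l} \<le> card ?S + card ?T"
      using card_mono[OF fin sub] card_Un_le[of ?S ?T] by linarith
    then have "real (card {m \<in> M. \<bar>s m + t m\<bar> > l}) \<le> (C / (l / 2)) powr p + (D / (l / 2)) powr p"
      using levC[OF l2] levD[OF l2] by linarith
    also have "\<dots> \<le> (2 * (C + D) / l) powr p + (2 * (C + D) / l) powr p"
      using C D l p by (intro add_mono powr_mono2) (auto simp: field_simps)
    also have "\<dots> = (B / l) powr p"
    proof -
      have "B / l = 2 powr (1 / p) * (2 * (C + D) / l)" by (simp add: B_def)
      then have "(B / l) powr p = (2 powr (1 / p)) powr p * (2 * (C + D) / l) powr p"
        using C D l by (simp only:, subst powr_mult) auto
      then show ?thesis using p by (simp add: powr_powr)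
    qed
    finally show ?thesis using finite_subset[OF sub fin] by simp
  qed
  moreover have "B \<ge> 0" using C D by (simp add: B_def)
  moreover have "{m \<in> M. l < \<bar>(\<lambda>m\<in>M. s m + t m) m\<bar>} = {m \<in> M. \<bar>s m + t m\<bar> > l}" for l
    by auto
  ultimately show ?thesis unfolding weak_lp_iff by auto
qed

lemma weak_lp_scale:
  assumes p: "p > 0" and s: "s \<in> weak_lp p M"
  shows "(\<lambda>m\<in>M. c * s m) \<in> weak_lp p M"
  by (rule weak_lp_dominated[OF p s, where K = "\<bar>c\<bar>" and R = "(=)" and N = 1])
    (auto simp: abs_mult card_le_Suc0_iff_eq)

lemma weak_lp_zero: "(\<lambda>m\<in>M. 0) \<in> weak_lp p M"
  unfolding weak_lp_iff by (intro conjI exI[of _ 0]) auto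

section \<open>Combinatorial distance\<close>

text \<open>
  The pairs at combinatorial distance at most \<open>n\<close>. Reflexive closure makes the relation increasing
  in \<open>n\<close>, and powers of relations compose additively, which is the triangle inequality.
\<close>

definition near :: "('v \<times> 'v) set \<Rightarrow> nat \<Rightarrow> ('v \<times> 'v) set" where
  "near E n = ((E \<union> E\<inverse>)\<^sup>=) ^^ n"

lemma near_0: "(x, y) \<in> near E 0 \<longleftrightarrow> x = y"
  by (simp add: near_def)

lemma near_1: "near E (Suc 0) = (E \<union> E\<inverse>)\<^sup>="
  by (simp add: near_def)

lemma edge_near: "e \<in> E \<Longrightarrow> (fst e, snd e) \<in> near E 1"
  by (simp add: near_1)

lemma near_add: "near E (m + n) = near E m O near E n"
  unfolding near_def by (rule relpow_add)

lemma near_trans: "(x, y) \<in> near E m \<Longrightarrow> (y, z) \<in> near E n \<Longrightarrow> (x, z) \<in> near E (m + n)"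
  by (auto simp: near_add)

lemma near_refl: "(x, x) \<in> near E n"
  by (induction n) (auto simp: near_def)

lemma near_mono: "(x, y) \<in> near E m \<Longrightarrow> m \<le> n \<Longrightarrow> (x, y) \<in> near E n"
  using near_trans[OF _ near_refl, of x y E m "n - m"] by simp

lemma near_SucE:
  assumes "(x, y) \<in> near E (Suc n)"
  obtains z where "(x, z) \<in> near E n" "(z, y) \<in> near E 1"
  using assms near_add[of E n 1] by auto

lemma near_sym: "(x, y) \<in> near E n \<Longrightarrow> (y, x) \<in> near E n"
proof (induction n arbitrary: y)
  case (Suc n)
  obtain z where "(x, z) \<in> near E n" "(z, y) \<in> near E 1" using Suc.prems by (rule near_SucE)
  then have "(y, z) \<in> near E 1" "(z, x) \<in> near E n" using Suc.IH by (auto simp: near_1)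
  then show ?case using near_trans[of y z E 1 x n] by simp
qed (simp add: near_0)

lemma near_in_vertices:
  assumes "E \<subseteq> V \<times> V" "x \<in> V" "(x, y) \<in> near E n"
  shows "y \<in> V"
  using assms(3)
proof (induction n arbitrary: y)
  case 0
  then show ?case using assms(2) by (simp add: near_0)
next
  case (Suc n)
  from Suc.prems obtain z where "(x, z) \<in> near E n" "(z, y) \<in> near E 1" by (rule near_SucE)
  then show ?case using Suc.IH assms(1) by (auto simp: near_1)
qed

lemma connected_near:
  assumes "connected_graph V E" "x \<in> V" "y \<in> V"
  obtains n where "(x, y) \<in> near E n"
proof -
  have "(x, y) \<in> ((E \<union> E\<inverse>)\<^sup>=)\<^sup>*" using assms by (simp add: connected_graph_def)
  then show ?thesis using that unfolding near_def rtrancl_power by blast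
qed

lemma bounded_balls:
  assumes "E \<subseteq> V \<times> V" "bounded_degree V E"
  obtains N where "\<And>x. x \<in> V \<Longrightarrow> finite {y. (x, y) \<in> near E n} \<and> card {y. (x, y) \<in> near E n} \<le> N"
proof -
  obtain D where D: "\<And>v. v \<in> V \<Longrightarrow> finite {e \<in> E. fst e = v \<or> snd e = v} \<and>
                     card {e \<in> E. fst e = v \<or> snd e = v} \<le> D"
    using assms(2) unfolding bounded_degree_def by blast
  have one: "finite {y. (x, y) \<in> near E 1} \<and> card {y. (x, y) \<in> near E 1} \<le> Suc D" if x: "x \<in> V" for x
  proof -
    let ?I = "{e \<in> E. fst e = x \<or> snd e = x}"
    \<comment> \<open>The neighbours of \<open>x\<close> are the other ends of the edges at \<open>x\<close>.\<close>
    let ?other = "\<lambda>e. if fst e = x then snd e else fst e"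
    have sub: "{y. (x, y) \<in> near E 1} \<subseteq> insert x (?other ` ?I)"
    proof
      fix y assume "y \<in> {y. (x, y) \<in> near E 1}"
      then consider "y = x" | "(x, y) \<in> E" | "(y, x) \<in> E" by (auto simp: near_1)
      then show "y \<in> insert x (?other ` ?I)"
      proof cases
        case 2
        then show ?thesis by (intro insertI2 image_eqI[of _ _ "(x, y)"]) auto
      next
        case 3
        then show ?thesis by (cases "y = x") (auto intro!: image_eqI[of _ _ "(y, x)"])
      qed simp
    qed
    have "card {y. (x, y) \<in> near E 1} \<le> card (insert x (?other ` ?I))"
      using D[OF x] sub by (intro card_mono) auto
    also have "\<dots> \<le> Suc (card (?other ` ?I))" by (rule card_insert_le_m1) auto
    also have "\<dots> \<le> Suc D" using card_image_le[of ?I ?other] D[OF x] by auto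
    finally show ?thesis using finite_subset[OF sub] D[OF x] by auto
  qed
  have "\<exists>N. \<forall>x\<in>V. finite {y. (x, y) \<in> near E n} \<and> card {y. (x, y) \<in> near E n} \<le> N"
  proof (induction n)
    case 0
    then show ?case by (intro exI[of _ 1]) (simp add: near_0)
  next
    case (Suc n)
    then obtain N where N: "\<And>x. x \<in> V \<Longrightarrow> finite {y. (x, y) \<in> near E n}"
        "\<And>x. x \<in> V \<Longrightarrow> card {y. (x, y) \<in> near E n} \<le> N" by blast
    show ?case
    proof (intro exI[of _ "N * Suc D"] ballI)
      fix x assume x: "x \<in> V"
      let ?B = "{y. (x, y) \<in> near E n}"
      have V: "y \<in> V" if "y \<in> ?B" for y using near_in_vertices[OF assms(1) x] that by simp
      have eq: "{z. (x, z) \<in> near E (Suc n)} = (\<Union>y\<in>?B. {z. (y, z) \<in> near E 1})"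
        using near_add[of E n 1] by auto
      have "card (\<Union>y\<in>?B. {z. (y, z) \<in> near E 1}) \<le> (\<Sum>y\<in>?B. card {z. (y, z) \<in> near E 1})"
        by (intro card_UN_le N x)
      also have "\<dots> \<le> (\<Sum>y\<in>?B. Suc D)" using one V by (intro sum_mono) auto
      also have "\<dots> = card ?B * Suc D" by simp
      also have "\<dots> \<le> N * Suc D" using N(2)[OF x] by (intro mult_right_mono) auto
      finally show "finite {z. (x, z) \<in> near E (Suc n)} \<and> card {z. (x, z) \<in> near E (Suc n)} \<le> N * Suc D"
        unfolding eq using N(1)[OF x] one V by auto
    qed
  qed
  then show ?thesis using that by blast
qed

section \<open>Path metric and combinatorial distance\<close>

text \<open>
  An interior point is rounded to the initial vertex of its edge, at distance less than 1.
\<close>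

fun round_point :: "'v graph_point \<Rightarrow> 'v" where
  "round_point (Vertex v) = v"
| "round_point (Interior e t) = fst e"

fun linear_extension :: "('v \<Rightarrow> real) \<Rightarrow> 'v graph_point \<Rightarrow> real" where
  "linear_extension d (Vertex v) = d v"
| "linear_extension d (Interior e t) = (1 - t) * d (fst e) + t * d (snd e)"

lemma round_point_in: "E \<subseteq> V \<times> V \<Longrightarrow> x \<in> realization V E \<Longrightarrow> round_point x \<in> V"
  by (auto simp: realization_def)

lemma linear_extension_edge_point:
  "linear_extension d (edge_point e t) = (1 - t) * d (fst e) + t * d (snd e)"
  by (simp add: edge_point_def)

text \<open>
  On a closed edge the extension is affine with slope at most 1 in absolute value, so each affine
  segment of a path changes it by at most the length of the segment.
\<close>

lemma linear_extension_path:
  assumes "piecewise_linear_path E x y l" and lip: "\<And>e. e \<in> E \<Longrightarrow> \<bar>d (snd e) - d (fst e)\<bar> \<le> 1"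
  shows "linear_extension d x - linear_extension d y \<le> l"
  using assms(1)
proof induction
  case (segment e s t y l)
  have "linear_extension d (edge_point e s) - linear_extension d (edge_point e t)
      = (s - t) * (d (snd e) - d (fst e))"
    by (simp add: linear_extension_edge_point algebra_simps)
  also have "\<dots> \<le> \<bar>s - t\<bar> * \<bar>d (snd e) - d (fst e)\<bar>"
    by (metis abs_ge_self abs_mult)
  also have "\<dots> \<le> \<bar>s - t\<bar> * 1" by (intro mult_left_mono lip segment) auto
  finally show ?case using segment by simp
qed simp

lemma path_nonneg: "piecewise_linear_path E x y l \<Longrightarrow> 0 \<le> l"
  by (induction rule: piecewise_linear_path.induct) auto

lemma path_from_near:
  assumes "(x, y) \<in> near E n" "piecewise_linear_path E (Vertex y) q l"
  shows "\<exists>l'\<le>real n + l. piecewise_linear_path E (Vertex x) q l'"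
  using assms
proof (induction n arbitrary: y l)
  case 0
  then show ?case by (auto simp: near_0)
next
  case (Suc n)
  then obtain z where z: "(x, z) \<in> near E n" "(z, y) \<in> near E 1" by (auto elim: near_SucE)
  have "\<exists>l'\<le>1 + l. piecewise_linear_path E (Vertex z) q l'"
  proof -
    consider "z = y" | "(z, y) \<in> E" | "(y, z) \<in> E" using z(2) by (auto simp: near_1)
    then show ?thesis
    proof cases
      case 1
      then show ?thesis using Suc.prems(2) by (intro exI[of _ l]) auto
    next
      case 2
      have "piecewise_linear_path E (edge_point (z, y) 0) q (\<bar>0 - 1\<bar> + l)"
        by (rule piecewise_linear_path.segment) (use 2 Suc.prems in \<open>auto simp: edge_point_def\<close>)
      then show ?thesis by (intro exI[of _ "1 + l"]) (simp add: edge_point_def)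
    next
      case 3
      have "piecewise_linear_path E (edge_point (y, z) 1) q (\<bar>1 - 0\<bar> + l)"
        by (rule piecewise_linear_path.segment) (use 3 Suc.prems in \<open>auto simp: edge_point_def\<close>)
      then show ?thesis by (intro exI[of _ "1 + l"]) (simp add: edge_point_def)
    qed
  qed
  then obtain l' where l': "l' \<le> 1 + l" "piecewise_linear_path E (Vertex z) q l'" by blast
  obtain m where "m \<le> real n + l'" "piecewise_linear_path E (Vertex x) q m"
    using Suc.IH[OF z(1) l'(2)] by blast
  then show ?case using l'(1) by (intro exI[of _ m]) auto
qed

lemma path_to_round:
  assumes "x \<in> realization V E" "piecewise_linear_path E (Vertex (round_point x)) q l"
  shows "\<exists>l'\<le>1 + l. piecewise_linear_path E x q l'"
proof (cases x)
  case (Vertex v)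
  then show ?thesis using assms(2) by (intro exI[of _ l]) auto
next
  case (Interior e t)
  then have t: "e \<in> E" "0 < t" "t < 1" using assms(1) by (auto simp: realization_def)
  have "piecewise_linear_path E (edge_point e t) q (\<bar>t - 0\<bar> + l)"
    by (rule piecewise_linear_path.segment) (use t assms(2) Interior in \<open>auto simp: edge_point_def\<close>)
  then show ?thesis using t Interior by (intro exI[of _ "t + l"]) (auto simp: edge_point_def)
qed

lemma path_from_round:
  assumes "x \<in> realization V E"
  shows "\<exists>l\<le>1. piecewise_linear_path E (Vertex (round_point x)) x l"
proof (cases x)
  case (Vertex v)
  then show ?thesis by (intro exI[of _ 0]) (auto intro: piecewise_linear_path.const)
next
  case (Interior e t)
  then have t: "e \<in> E" "0 < t" "t < 1" using assms(1) by (auto simp: realization_def)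
  have "piecewise_linear_path E (edge_point e 0) x (\<bar>0 - t\<bar> + 0)"
    by (rule piecewise_linear_path.segment)
      (use t Interior in \<open>auto simp: edge_point_def intro: piecewise_linear_path.const\<close>)
  then show ?thesis using t Interior by (intro exI[of _ t]) (auto simp: edge_point_def)
qed

text \<open>
  Each of the two roundings costs at most 1.
\<close>

lemma path_of_near:
  assumes "x \<in> realization V E" "y \<in> realization V E" "(round_point x, round_point y) \<in> near E n"
  shows "\<exists>l\<le>real n + 2. piecewise_linear_path E x y l"
proof -
  obtain l where l: "l \<le> 1" "piecewise_linear_path E (Vertex (round_point y)) y l"
    using path_from_round[OF assms(2)] by blast
  obtain l' where l': "l' \<le> real n + l" "piecewise_linear_path E (Vertex (round_point x)) y l'"
    using path_from_near[OF assms(3) l(2)] by blast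
  obtain l'' where "l'' \<le> 1 + l'" "piecewise_linear_path E x y l''"
    using path_to_round[OF assms(1) l'(2)] by blast
  then show ?thesis using l l' by (intro exI[of _ l'']) auto
qed

lemma path_dist_le_near:
  assumes "x \<in> realization V E" "y \<in> realization V E" "(round_point x, round_point y) \<in> near E n"
  shows "path_dist E x y \<le> real n + 2"
proof -
  obtain l where l: "l \<le> real n + 2" "piecewise_linear_path E x y l" using path_of_near[OF assms] by blast
  have "path_dist E x y \<le> l"
    unfolding path_dist_def by (rule cInf_lower) (use l path_nonneg in \<open>auto intro!: bdd_belowI[of _ 0]\<close>)
  then show ?thesis using l by simp
qed

text \<open>
  The Lipschitz function in question is the combinatorial distance to the vertex that rounds \<open>y\<close>. Its
  linear extension changes by at most \<open>l\<close> along the path and differs by at most 1 at each end from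
  the value at the rounded vertex. A direct count of the segments of the path is not possible, since
  a short path may have many of them.
\<close>

lemma near_of_path:
  assumes V: "E \<subseteq> V \<times> V" "connected_graph V E" "x \<in> realization V E" "y \<in> realization V E"
    and path: "piecewise_linear_path E x y l" and l: "l \<le> real n"
  shows "(round_point x, round_point y) \<in> near E (n + 2)"
proof -
  define b where "b = round_point y"
  define d where "d v = (LEAST k. (v, b) \<in> near E k)" for v
  have b: "b \<in> V" using round_point_in V by (simp add: b_def)
  have d: "(v, b) \<in> near E (d v)" if "v \<in> V" for v
    unfolding d_def by (rule connected_near[OF V(2) that b], rule LeastI)
  have step: "d u \<le> 1 + d v" if "(u, v) \<in> near E 1" "v \<in> V" for u v
    unfolding d_def[of u] by (rule Least_le) (rule near_trans[OF that(1) d[OF that(2)]])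
  have lip: "\<bar>real (d (snd e)) - real (d (fst e))\<bar> \<le> 1" if e: "e \<in> E" for e
  proof -
    have "fst e \<in> V" "snd e \<in> V" using V e by auto
    then have "d (fst e) \<le> 1 + d (snd e)" "d (snd e) \<le> 1 + d (fst e)"
      using step edge_near[OF e] near_sym[OF edge_near[OF e]] by blast+
    then show ?thesis by linarith
  qed
  have close: "\<bar>linear_extension (\<lambda>v. real (d v)) z - real (d (round_point z))\<bar> \<le> 1"
    if z: "z \<in> realization V E" for z
  proof (cases z)
    case (Interior e t)
    then have t: "e \<in> E" "0 < t" "t < 1" using z by (auto simp: realization_def)
    have "linear_extension (\<lambda>v. real (d v)) z - real (d (round_point z))
        = t * (real (d (snd e)) - real (d (fst e)))"
      using Interior by (simp add: algebra_simps)
    also have "\<bar>\<dots>\<bar> \<le> 1 * 1" unfolding abs_mult using t lip[OF t(1)] by (intro mult_mono) auto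
    finally show ?thesis by simp
  qed simp
  have "d b = 0" unfolding d_def by (simp add: near_0 Least_eq_0)
  then have "real (d (round_point x)) \<le> l + 2"
    using linear_extension_path[where d = "\<lambda>v. real (d v)", OF path lip] close[OF V(3)] close[OF V(4)]
    unfolding b_def[symmetric] by linarith
  then have "d (round_point x) \<le> n + 2" using l by linarith
  then show ?thesis using near_mono[OF d[OF round_point_in[OF V(1,3)]]] b_def by simp
qed

lemma near_of_path_dist:
  assumes V: "E \<subseteq> V \<times> V" "connected_graph V E" "x \<in> realization V E" "y \<in> realization V E"
    and dist: "path_dist E x y \<le> B"
  shows "(round_point x, round_point y) \<in> near E (nat \<lceil>B\<rceil> + 3)"
proof -
  obtain n where "(round_point x, round_point y) \<in> near E n"
    using connected_near[OF V(2)] round_point_in[OF V(1)] V(3,4) by metis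
  then have ne: "{l. piecewise_linear_path E x y l} \<noteq> {}" using path_of_near[OF V(3,4)] by blast
  \<comment> \<open>The infimum need not be attained, so the bound is relaxed by 1.\<close>
  have "Inf {l. piecewise_linear_path E x y l} < B + 1" using dist by (simp add: path_dist_def)
  then obtain l where l: "piecewise_linear_path E x y l" "l < B + 1"
    using cInf_lessD[OF ne] by blast
  then have "l \<le> real (nat \<lceil>B\<rceil> + 1)" by linarith
  from near_of_path[OF V l(1) this] show ?thesis by (simp add: numeral_eq_Suc)
qed

section \<open>From a quasi-isometry to coarse inverse maps of vertices\<close>

definition coarse_lipschitz :: "('v \<times> 'v) set \<Rightarrow> ('w \<times> 'w) set \<Rightarrow> nat \<Rightarrow> ('v \<Rightarrow> 'w) \<Rightarrow> bool" where
  "coarse_lipschitz E E' k f \<longleftrightarrow> (\<forall>e\<in>E. (f (fst e), f (snd e)) \<in> near E' k)"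

text \<open>
  Rounding changes distances by a bounded amount, so both inequalities of the quasi-isometry \<open>\<phi>\<close>
  become implications between combinatorial distances (\<open>up\<close> and \<open>low\<close> in the proof). The map \<open>f\<close> is
  \<open>\<phi>\<close> on vertices followed by rounding. For \<open>g\<close>, coarse density provides for each vertex \<open>y\<close> of the target a
  point \<open>h y\<close> whose image is near \<open>y\<close>, and \<open>g y\<close> is \<open>h y\<close> rounded. As \<open>\<phi> (h y)\<close> is near \<open>y\<close>, the lower
  inequality of \<open>\<phi>\<close> turns closeness of \<open>y\<close> and \<open>y'\<close> into closeness of \<open>g y\<close> and \<open>g y'\<close>.
\<close>

lemma quasi_isometric_coarse_inverses:
  assumes V: "E \<subseteq> V \<times> V" "connected_graph V E" and V': "E' \<subseteq> V' \<times> V'" "connected_graph V' E'"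
    and qi: "quasi_isometric (realization V E) (path_dist E) (realization V' E') (path_dist E')"
  obtains f g k where "f \<in> V \<rightarrow> V'" "g \<in> V' \<rightarrow> V"
    "coarse_lipschitz E E' k f" "coarse_lipschitz E' E k g"
    "\<And>x. x \<in> V \<Longrightarrow> (g (f x), x) \<in> near E k" "\<And>y. y \<in> V' \<Longrightarrow> (f (g y), y) \<in> near E' k"
proof -
  let ?X = "realization V E" and ?Y = "realization V' E'"
  obtain \<phi> L K where \<phi>: "\<phi> \<in> ?X \<rightarrow> ?Y" and L: "L \<ge> 1" and K: "K \<ge> (0::real)"
    and lower: "\<And>x x'. x \<in> ?X \<Longrightarrow> x' \<in> ?X \<Longrightarrow> (1 / L) * path_dist E x x' - K \<le> path_dist E' (\<phi> x) (\<phi> x')"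
    and upper: "\<And>x x'. x \<in> ?X \<Longrightarrow> x' \<in> ?X \<Longrightarrow> path_dist E' (\<phi> x) (\<phi> x') \<le> L * path_dist E x x' + K"
    and dense: "(SUP y\<in>?Y. INF x\<in>?X. ereal (path_dist E' y (\<phi> x))) \<le> ereal K"
    using qi unfolding quasi_isometric_def by blast
  define r where "r x = round_point (\<phi> x)" for x
  have \<phi>Y: "\<phi> x \<in> ?Y" if "x \<in> ?X" for x using \<phi> that by auto
  have r: "r x \<in> V'" if "x \<in> ?X" for x using round_point_in[OF V'(1) \<phi>Y[OF that]] by (simp add: r_def)
  have vert: "Vertex v \<in> ?X" if "v \<in> V" for v using that by (simp add: realization_def)
  have vert': "Vertex v \<in> ?Y" if "v \<in> V'" for v using that by (simp add: realization_def)
  define up where "up n = nat \<lceil>L * (real n + 2) + K\<rceil> + 3" for n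
  have up: "(r x, r x') \<in> near E' (up n)"
    if "x \<in> ?X" "x' \<in> ?X" "(round_point x, round_point x') \<in> near E n" for x x' n
  proof -
    have "path_dist E' (\<phi> x) (\<phi> x') \<le> L * path_dist E x x' + K" by (rule upper[OF that(1,2)])
    also have "\<dots> \<le> L * (real n + 2) + K"
      using path_dist_le_near[OF that] L by (intro add_right_mono mult_left_mono) auto
    finally show ?thesis unfolding r_def up_def by (rule near_of_path_dist[OF V' \<phi>Y[OF that(1)] \<phi>Y[OF that(2)]])
  qed
  define low where "low n = nat \<lceil>L * (real n + 2 + K)\<rceil> + 3" for n
  have low: "(round_point x, round_point x') \<in> near E (low n)"
    if "x \<in> ?X" "x' \<in> ?X" "(r x, r x') \<in> near E' n" for x x' n
  proof -
    have "(1 / L) * path_dist E x x' \<le> real n + 2 + K"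
      using lower[OF that(1,2)] path_dist_le_near[OF \<phi>Y[OF that(1)] \<phi>Y[OF that(2)], of n] that(3)
      by (simp add: r_def)
    then have "path_dist E x x' \<le> L * (real n + 2 + K)" using L by (simp add: field_simps)
    then show ?thesis unfolding low_def by (rule near_of_path_dist[OF V that(1,2)])
  qed
  define c where "c = nat \<lceil>K + 1\<rceil> + 3"
  \<comment> \<open>The infimum over the points of the domain need not be attained either, hence \<open>K + 1\<close> in \<open>c\<close>.\<close>
  have "\<exists>x\<in>?X. (y, r x) \<in> near E' c" if y: "y \<in> V'" for y
  proof -
    have "(INF x\<in>?X. ereal (path_dist E' (Vertex y) (\<phi> x))) \<le> ereal K"
      using SUP_upper[OF vert'[OF y], of "\<lambda>y. INF x\<in>?X. ereal (path_dist E' y (\<phi> x))"] dense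
      by (rule order_trans)
    also have "\<dots> < ereal (K + 1)" by simp
    finally obtain x where x: "x \<in> ?X" "path_dist E' (Vertex y) (\<phi> x) \<le> K + 1"
      unfolding INF_less_iff by auto
    then show ?thesis
      using near_of_path_dist[OF V' vert'[OF y] \<phi>Y[OF x(1)] x(2)] by (auto simp: r_def c_def)
  qed
  then obtain h where h: "\<And>y. y \<in> V' \<Longrightarrow> h y \<in> ?X" "\<And>y. y \<in> V' \<Longrightarrow> (y, r (h y)) \<in> near E' c" by metis
  define f where "f v = r (Vertex v)" for v
  define g where "g y = round_point (h y)" for y
  define k where "k = Max {up 1, low (c + 1 + c), up 0 + c, low c}"
  have k: "up 1 \<le> k" "low (c + 1 + c) \<le> k" "up 0 + c \<le> k" "low c \<le> k" by (auto simp: k_def)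
  have g: "g y \<in> V" if "y \<in> V'" for y using round_point_in[OF V(1) h(1)[OF that]] by (simp add: g_def)
  have f: "f x \<in> V'" if "x \<in> V" for x using r vert that by (simp add: f_def)
  show ?thesis
  proof
    show "f \<in> V \<rightarrow> V'" "g \<in> V' \<rightarrow> V" using f g by auto
    show "coarse_lipschitz E E' k f"
      unfolding coarse_lipschitz_def
    proof
      fix e assume e: "e \<in> E"
      then have "fst e \<in> V" "snd e \<in> V" using V by auto
      then show "(f (fst e), f (snd e)) \<in> near E' k"
        unfolding f_def using near_mono[OF up k(1)] vert edge_near[OF e] by simp
    qed
    show "coarse_lipschitz E' E k g"
      unfolding coarse_lipschitz_def
    proof
      fix e assume e: "e \<in> E'"
      then have ev: "fst e \<in> V'" "snd e \<in> V'" using V' by auto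
      have "(r (h (fst e)), r (h (snd e))) \<in> near E' (c + 1 + c)"
        using near_sym[OF h(2)[OF ev(1)]] edge_near[OF e] h(2)[OF ev(2)] by (blast intro: near_trans)
      then show "(g (fst e), g (snd e)) \<in> near E k"
        unfolding g_def using near_mono[OF low k(2)] h(1) ev by simp
    qed
    show "(g (f x), x) \<in> near E k" if x: "x \<in> V" for x
    proof -
      have "(r (h (f x)), r (Vertex x)) \<in> near E' c"
        using near_sym[OF h(2)[OF f[OF x]]] by (simp add: f_def)
      then have "(round_point (h (f x)), round_point (Vertex x)) \<in> near E (low c)"
        using low h(1)[OF f[OF x]] vert[OF x] by blast
      then show ?thesis unfolding g_def using near_mono[OF _ k(4)] by simp
    qed
    show "(f (g y), y) \<in> near E' k" if y: "y \<in> V'" for y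
    proof -
      have "(r (Vertex (g y)), r (h y)) \<in> near E' (up 0)"
        using up[OF vert[OF g[OF y]] h(1)[OF y]] by (simp add: g_def near_0)
      then have "(f (g y), y) \<in> near E' (up 0 + c)"
        unfolding f_def using near_sym[OF h(2)[OF y]] by (rule near_trans)
      then show ?thesis by (rule near_mono[OF _ k(3)])
    qed
  qed
qed

section \<open>The quotient space\<close>

lemma mem_wk_null:
  "n \<in> wk_null p V \<longleftrightarrow> n \<in> extensional V \<and> (\<exists>c. (\<lambda>x\<in>V. n x - c) \<in> weak_lp p V)"
proof
  assume "n \<in> wk_null p V"
  then obtain c s where n: "n = (\<lambda>v\<in>V. c + s v)" and s: "s \<in> weak_lp p V" by (auto simp: wk_null_def)
  have "(\<lambda>x\<in>V. n x - c) = s" using s by (auto simp: n weak_lp_iff extensional_def restrict_def)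
  then show "n \<in> extensional V \<and> (\<exists>c. (\<lambda>x\<in>V. n x - c) \<in> weak_lp p V)"
    using s n by (metis restrict_extensional)
next
  assume "n \<in> extensional V \<and> (\<exists>c. (\<lambda>x\<in>V. n x - c) \<in> weak_lp p V)"
  then obtain c where n: "n \<in> extensional V" and s: "(\<lambda>x\<in>V. n x - c) \<in> weak_lp p V" by blast
  have "n = (\<lambda>v\<in>V. c + (\<lambda>x\<in>V. n x - c) v)" using n by (auto simp: extensional_def restrict_def)
  then show "n \<in> wk_null p V" unfolding wk_null_def using s by blast
qed

lemma weak_lp_subset_wk_null: "s \<in> weak_lp p V \<Longrightarrow> s \<in> wk_null p V"
proof -
  assume s: "s \<in> weak_lp p V"
  then have "(\<lambda>x\<in>V. s x - 0) = s" by (auto simp: weak_lp_iff extensional_def restrict_def)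
  then show ?thesis using s unfolding mem_wk_null by (metis weak_lp_iff)
qed

lemma wk_null_add:
  assumes "p > 0" "m \<in> wk_null p V" "n \<in> wk_null p V"
  shows "(\<lambda>x\<in>V. m x + n x) \<in> wk_null p V"
proof -
  obtain c d where "(\<lambda>x\<in>V. m x - c) \<in> weak_lp p V" "(\<lambda>x\<in>V. n x - d) \<in> weak_lp p V"
    using assms by (auto simp: mem_wk_null)
  from weak_lp_add[OF assms(1) this] have "(\<lambda>x\<in>V. (\<lambda>x\<in>V. m x + n x) x - (c + d)) \<in> weak_lp p V"
    by (simp add: algebra_simps cong: restrict_cong)
  then show ?thesis unfolding mem_wk_null by blast
qed

lemma wk_null_scale:
  assumes "p > 0" "n \<in> wk_null p V"
  shows "(\<lambda>x\<in>V. a * n x) \<in> wk_null p V"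
proof -
  obtain c where "(\<lambda>x\<in>V. n x - c) \<in> weak_lp p V" using assms by (auto simp: mem_wk_null)
  from weak_lp_scale[OF assms(1) this, of a] have "(\<lambda>x\<in>V. (\<lambda>x\<in>V. a * n x) x - a * c) \<in> weak_lp p V"
    by (simp add: algebra_simps cong: restrict_cong)
  then show ?thesis unfolding mem_wk_null by blast
qed

lemma mem_wk_class:
  "w \<in> wk_class p V u \<longleftrightarrow> w \<in> extensional V \<and> (\<lambda>x\<in>V. w x - u x) \<in> wk_null p V"
proof
  assume "w \<in> wk_class p V u"
  then obtain n where w: "w = (\<lambda>v\<in>V. u v + n v)" and n: "n \<in> wk_null p V" by (auto simp: wk_class_def)
  have "(\<lambda>x\<in>V. w x - u x) = n" using n by (auto simp: w mem_wk_null extensional_def restrict_def)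
  then show "w \<in> extensional V \<and> (\<lambda>x\<in>V. w x - u x) \<in> wk_null p V" using n w by auto
next
  assume *: "w \<in> extensional V \<and> (\<lambda>x\<in>V. w x - u x) \<in> wk_null p V"
  then have "w = (\<lambda>v\<in>V. u v + (\<lambda>x\<in>V. w x - u x) v)" by (auto simp: extensional_def restrict_def)
  then show "w \<in> wk_class p V u" unfolding wk_class_def using * by blast
qed

lemma wk_class_self: "u \<in> extensional V \<Longrightarrow> u \<in> wk_class p V u"
  using weak_lp_subset_wk_null[OF weak_lp_zero[of V p]] by (simp add: mem_wk_class)

text \<open>
  The null functions are closed under sums and multiples, so the classes are cosets of a subspace.
\<close>

lemma wk_class_eq:
  assumes p: "p > 0" and uw: "(\<lambda>x\<in>V. u x - w x) \<in> wk_null p V"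
  shows "wk_class p V u = wk_class p V w"
proof -
  have wu: "(\<lambda>x\<in>V. w x - u x) \<in> wk_null p V"
    using wk_null_scale[OF p uw, of "-1"] by (simp cong: restrict_cong)
  have "wk_class p V a \<subseteq> wk_class p V b" if "(\<lambda>x\<in>V. a x - b x) \<in> wk_null p V" for a b
  proof
    fix v assume "v \<in> wk_class p V a"
    then have v: "v \<in> extensional V" "(\<lambda>x\<in>V. v x - a x) \<in> wk_null p V" by (simp_all add: mem_wk_class)
    from wk_null_add[OF p v(2) that] have "(\<lambda>x\<in>V. v x - b x) \<in> wk_null p V"
      by (simp cong: restrict_cong)
    then show "v \<in> wk_class p V b" using v(1) by (simp add: mem_wk_class)
  qed
  from this[OF uw] this[OF wu] show ?thesis by blast
qed

text \<open>
  An operation that is defined as a union over representatives and respects classes is computed by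
  any one representative.
\<close>

lemma union_over_wk_class:
  assumes "u \<in> extensional V" "\<And>w. w \<in> wk_class p V u \<Longrightarrow> F w = F u"
  shows "(\<Union>w\<in>wk_class p V u. F w) = F u"
  using assms wk_class_self[OF assms(1)] by blast

lemma Wk_add_class:
  assumes p: "p > 0" and u: "u \<in> extensional V" and w: "w \<in> extensional V"
  shows "sn_add (Wk p V E) (wk_class p V u) (wk_class p V w) = wk_class p V (\<lambda>v\<in>V. u v + w v)"
proof -
  have eq: "wk_class p V (\<lambda>v\<in>V. a v + b v) = wk_class p V (\<lambda>v\<in>V. u v + w v)"
    if "a \<in> wk_class p V u" "b \<in> wk_class p V w" for a b
  proof (rule wk_class_eq[OF p])
    have "(\<lambda>x\<in>V. a x - u x) \<in> wk_null p V" "(\<lambda>x\<in>V. b x - w x) \<in> wk_null p V"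
      using that by (auto simp: mem_wk_class)
    from wk_null_add[OF p this] show "(\<lambda>x\<in>V. (\<lambda>v\<in>V. a v + b v) x - (\<lambda>v\<in>V. u v + w v) x) \<in> wk_null p V"
      by (simp add: algebra_simps cong: restrict_cong)
  qed
  have "(\<Union>a\<in>wk_class p V u. \<Union>b\<in>wk_class p V w. wk_class p V (\<lambda>v\<in>V. a v + b v))
      = (\<Union>a\<in>wk_class p V u. \<Union>b\<in>wk_class p V w. wk_class p V (\<lambda>v\<in>V. u v + w v))"
    by (intro SUP_cong refl eq)
  also have "\<dots> = wk_class p V (\<lambda>v\<in>V. u v + w v)"
    using wk_class_self[OF u, of p] wk_class_self[OF w, of p] by blast
  finally show ?thesis by (simp add: Wk_def)
qed

lemma Wk_scale_class:
  assumes p: "p > 0" and u: "u \<in> extensional V"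
  shows "sn_scale (Wk p V E) c (wk_class p V u) = wk_class p V (\<lambda>v\<in>V. c * u v)"
proof -
  have "wk_class p V (\<lambda>v\<in>V. c * a v) = wk_class p V (\<lambda>v\<in>V. c * u v)"
    if "a \<in> wk_class p V u" for a
  proof (rule wk_class_eq[OF p])
    have "(\<lambda>x\<in>V. a x - u x) \<in> wk_null p V" using that by (simp add: mem_wk_class)
    from wk_null_scale[OF p this, of c] show "(\<lambda>x\<in>V. (\<lambda>v\<in>V. c * a v) x - (\<lambda>v\<in>V. c * u v) x) \<in> wk_null p V"
      by (simp add: algebra_simps cong: restrict_cong)
  qed
  then have "(\<Union>a\<in>wk_class p V u. wk_class p V (\<lambda>v\<in>V. c * a v)) = wk_class p V (\<lambda>v\<in>V. c * u v)"
    by (rule union_over_wk_class[OF u])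
  then show ?thesis by (simp add: Wk_def)
qed

lemma edge_diff_extensional: "edge_diff E u \<in> extensional E"
  unfolding edge_diff_def by (rule restrict_extensional)

lemma edge_diff_add:
  "E \<subseteq> V \<times> V \<Longrightarrow> edge_diff E (\<lambda>v\<in>V. u v + w v) = (\<lambda>e\<in>E. edge_diff E u e + edge_diff E w e)"
  by (auto simp: edge_diff_def restrict_def fun_eq_iff)

lemma wk_functions_iff: "u \<in> wk_functions p V E \<longleftrightarrow> u \<in> extensional V \<and> edge_diff E u \<in> weak_lp p E"
  by (auto simp: wk_functions_def PiE_def)

lemma wk_functions_add:
  assumes "E \<subseteq> V \<times> V" "p > 0" "u \<in> wk_functions p V E" "w \<in> wk_functions p V E"
  shows "(\<lambda>v\<in>V. u v + w v) \<in> wk_functions p V E"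
  using assms by (auto simp: wk_functions_iff edge_diff_add intro: weak_lp_add)

text \<open>
  The difference along an edge is at most twice the larger of the absolute values at its two ends,
  and each vertex is an end of boundedly many edges.
\<close>

lemma wk_null_subset_wk_functions:
  assumes V: "E \<subseteq> V \<times> V" and deg: "bounded_degree V E" and p: "p > 0" and n: "n \<in> wk_null p V"
  shows "n \<in> wk_functions p V E"
proof -
  obtain D where D: "\<And>v. v \<in> V \<Longrightarrow> finite {e \<in> E. fst e = v \<or> snd e = v} \<and>
                     card {e \<in> E. fst e = v \<or> snd e = v} \<le> D"
    using deg unfolding bounded_degree_def by blast
  obtain c where s: "(\<lambda>x\<in>V. n x - c) \<in> weak_lp p V" using n by (auto simp: mem_wk_null)
  have "edge_diff E n \<in> weak_lp p E"
  proof (rule weak_lp_dominated[OF p s, where K = 2 and R = "\<lambda>e v. fst e = v \<or> snd e = v" and N = D])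
    fix e assume e: "e \<in> E"
    then have "fst e \<in> V" "snd e \<in> V" using V by auto
    moreover have "\<bar>edge_diff E n e\<bar> \<le> 2 * \<bar>n (fst e) - c\<bar> \<or> \<bar>edge_diff E n e\<bar> \<le> 2 * \<bar>n (snd e) - c\<bar>"
    proof -
      have "edge_diff E n e = (n (snd e) - c) - (n (fst e) - c)" using e by (simp add: edge_diff_def)
      then have "\<bar>edge_diff E n e\<bar> \<le> \<bar>n (snd e) - c\<bar> + \<bar>n (fst e) - c\<bar>"
        by (simp only: abs_triangle_ineq4)
      then show ?thesis by (cases "\<bar>n (snd e) - c\<bar> \<le> \<bar>n (fst e) - c\<bar>") simp_all
    qed
    ultimately show "\<exists>v\<in>V. (fst e = v \<or> snd e = v) \<and> \<bar>edge_diff E n e\<bar> \<le> 2 * \<bar>(\<lambda>x\<in>V. n x - c) v\<bar>"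
      by auto
  qed (use D in \<open>auto intro: edge_diff_extensional\<close>)
  then show ?thesis using n by (simp add: wk_functions_iff mem_wk_null)
qed

lemma wk_class_subset_wk_functions:
  assumes "E \<subseteq> V \<times> V" "bounded_degree V E" "p > 0" "u \<in> wk_functions p V E" "w \<in> wk_class p V u"
  shows "w \<in> wk_functions p V E"
proof -
  obtain n where "w = (\<lambda>v\<in>V. u v + n v)" "n \<in> wk_null p V" using assms(5) by (auto simp: wk_class_def)
  then show ?thesis using wk_functions_add wk_null_subset_wk_functions assms by metis
qed

section \<open>Pulling functions back along a coarse equivalence\<close>

text \<open>
  Of the edges on a path from \<open>x\<close> to \<open>y\<close>, one with the largest difference of \<open>u\<close> serves. A single
  edge, instead of the sum over the path, is what the domination lemmas need.
\<close>

lemma difference_bounded_by_edge: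
  assumes "(x, y) \<in> near E n" "u x \<noteq> u y"
  shows "\<exists>e\<in>E. (x, fst e) \<in> near E n \<and> \<bar>u x - u y\<bar> \<le> real n * \<bar>edge_diff E u e\<bar>"
  using assms
proof (induction n arbitrary: y)
  case 0
  then show ?case by (simp add: near_0)
next
  case (Suc n)
  obtain z where z: "(x, z) \<in> near E n" "(z, y) \<in> near E 1" using Suc.prems(1) by (rule near_SucE)
  have xy: "(x, y) \<in> near E (Suc n)" "(x, z) \<in> near E (Suc n)" using Suc.prems(1) near_mono[OF z(1)] by auto
  have last: "u z = u y \<or> (\<exists>e\<in>E. (x, fst e) \<in> near E (Suc n) \<and> \<bar>u z - u y\<bar> = \<bar>edge_diff E u e\<bar>)"
    using z(2) xy by (fastforce simp: near_1 edge_diff_def)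
  have first: "u x = u z \<or> (\<exists>e\<in>E. (x, fst e) \<in> near E (Suc n) \<and> \<bar>u x - u z\<bar> \<le> real n * \<bar>edge_diff E u e\<bar>)"
    using Suc.IH[OF z(1)] near_mono[of x _ E n "Suc n"] by (meson le_SucI order_refl)
  consider "u x = u z" | "u z = u y" | d e where "d \<in> E" "(x, fst d) \<in> near E (Suc n)"
      "\<bar>u x - u z\<bar> \<le> real n * \<bar>edge_diff E u d\<bar>" "e \<in> E" "(x, fst e) \<in> near E (Suc n)"
      "\<bar>u z - u y\<bar> = \<bar>edge_diff E u e\<bar>"
    using first last by blast
  then show ?case
  proof cases
    case 1
    then show ?thesis using last Suc.prems(2) by (auto simp: algebra_simps)
  next
    case 2
    then show ?thesis using first Suc.prems(2) by (fastforce simp: algebra_simps)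
  next
    case 3
    let ?b = "if \<bar>edge_diff E u d\<bar> \<le> \<bar>edge_diff E u e\<bar> then e else d"
    have le: "\<bar>edge_diff E u d\<bar> \<le> \<bar>edge_diff E u ?b\<bar>" "\<bar>edge_diff E u e\<bar> \<le> \<bar>edge_diff E u ?b\<bar>" by auto
    have "\<bar>u x - u y\<bar> \<le> real n * \<bar>edge_diff E u d\<bar> + \<bar>edge_diff E u e\<bar>" using 3 by linarith
    also have "\<dots> \<le> real n * \<bar>edge_diff E u ?b\<bar> + \<bar>edge_diff E u ?b\<bar>"
      by (intro add_mono mult_left_mono le) auto
    also have "\<dots> = real (Suc n) * \<bar>edge_diff E u ?b\<bar>" by (simp add: algebra_simps)
    finally show ?thesis using 3 by (intro bexI[of _ ?b]) auto
  qed
qed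

text \<open>
  The conditions are symmetric under the exchange of the two graphs and of \<open>f\<close> and \<open>g\<close>, so what is
  proved for the operator induced by \<open>g\<close> also holds for the one induced by \<open>f\<close>.
\<close>

locale coarse_inverses =
  fixes V :: "'v set" and E :: "('v \<times> 'v) set" and V' :: "'w set" and E' :: "('w \<times> 'w) set"
    and f :: "'v \<Rightarrow> 'w" and g :: "'w \<Rightarrow> 'v" and k :: nat
  assumes edges: "E \<subseteq> V \<times> V" "E' \<subseteq> V' \<times> V'"
    and degree: "bounded_degree V E" "bounded_degree V' E'"
    and maps: "f \<in> V \<rightarrow> V'" "g \<in> V' \<rightarrow> V"
    and lipschitz: "coarse_lipschitz E E' k f" "coarse_lipschitz E' E k g"
    and inverse: "x \<in> V \<Longrightarrow> (g (f x), x) \<in> near E k" "y \<in> V' \<Longrightarrow> (f (g y), y) \<in> near E' k"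
begin

lemma swap: "coarse_inverses V' E' V E g f k"
  by unfold_locales (use edges degree maps lipschitz inverse in auto)

definition pullback :: "('v \<Rightarrow> real) \<Rightarrow> 'w \<Rightarrow> real" where
  "pullback u = (\<lambda>y\<in>V'. u (g y))"

text \<open>
  All the classes in the union coincide (see \<open>pullback_class_class\<close>); the union avoids a choice of
  representative.
\<close>

definition pullback_class :: "real \<Rightarrow> ('v \<Rightarrow> real) set \<Rightarrow> ('w \<Rightarrow> real) set" where
  "pullback_class p A = (\<Union>u\<in>A. wk_class p V' (pullback u))"

text \<open>
  A vertex \<open>y\<close> is near \<open>f (g y)\<close>, so the vertices that \<open>g\<close> sends into a ball lie in the balls of radius
  \<open>k\<close> around the images under \<open>f\<close> of the points of that ball.
\<close>

lemma preimage_of_ball: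
  obtains N where "\<And>x. x \<in> V \<Longrightarrow> finite {y \<in> V'. (g y, x) \<in> near E n} \<and> card {y \<in> V'. (g y, x) \<in> near E n} \<le> N"
proof -
  obtain N where N: "\<And>x. x \<in> V \<Longrightarrow> finite {y. (x, y) \<in> near E n} \<and> card {y. (x, y) \<in> near E n} \<le> N"
    using bounded_balls[OF edges(1) degree(1)] by metis
  obtain N' where N': "\<And>x. x \<in> V' \<Longrightarrow> finite {y. (x, y) \<in> near E' k} \<and> card {y. (x, y) \<in> near E' k} \<le> N'"
    using bounded_balls[OF edges(2) degree(2)] by metis
  have "finite {y \<in> V'. (g y, x) \<in> near E n} \<and> card {y \<in> V'. (g y, x) \<in> near E n} \<le> N * N'" if x: "x \<in> V" for x
  proof -
    let ?B = "{z. (x, z) \<in> near E n}"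
    let ?U = "\<Union>z\<in>?B. {y. (f z, y) \<in> near E' k}"
    have sub: "{y \<in> V'. (g y, x) \<in> near E n} \<subseteq> ?U" using inverse(2) by (auto dest: near_sym)
    have fV: "f z \<in> V'" if "z \<in> ?B" for z using maps(1) near_in_vertices[OF edges(1) x] that by auto
    have fin: "finite ?U" using N[OF x] N' fV by auto
    have "card ?U \<le> (\<Sum>z\<in>?B. card {y. (f z, y) \<in> near E' k})" using N[OF x] by (intro card_UN_le) auto
    also have "\<dots> \<le> (\<Sum>z\<in>?B. N')" using N' fV by (intro sum_mono) auto
    also have "\<dots> = card ?B * N'" by simp
    also have "\<dots> \<le> N * N'" using N[OF x] by (intro mult_right_mono) auto
    finally show ?thesis using finite_subset[OF sub fin] card_mono[OF fin sub] by linarith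
  qed
  then show ?thesis using that by blast
qed

lemma edge_preimage_of_ball:
  obtains N where "\<And>x. x \<in> V \<Longrightarrow> finite {e \<in> E'. (g (fst e), x) \<in> near E n} \<and>
    card {e \<in> E'. (g (fst e), x) \<in> near E n} \<le> N"
proof -
  obtain N where N: "\<And>x. x \<in> V \<Longrightarrow> finite {y \<in> V'. (g y, x) \<in> near E n} \<and> card {y \<in> V'. (g y, x) \<in> near E n} \<le> N"
    using preimage_of_ball by blast
  obtain D where D: "\<And>v. v \<in> V' \<Longrightarrow> finite {e \<in> E'. fst e = v \<or> snd e = v} \<and>
                     card {e \<in> E'. fst e = v \<or> snd e = v} \<le> D"
    using degree(2) unfolding bounded_degree_def by blast
  have "finite {e \<in> E'. (g (fst e), x) \<in> near E n} \<and> card {e \<in> E'. (g (fst e), x) \<in> near E n} \<le> N * D"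
    if x: "x \<in> V" for x
  proof -
    let ?B = "{y \<in> V'. (g y, x) \<in> near E n}"
    let ?U = "\<Union>y\<in>?B. {e \<in> E'. fst e = y \<or> snd e = y}"
    have sub: "{e \<in> E'. (g (fst e), x) \<in> near E n} \<subseteq> ?U" using edges(2) by auto
    have fin: "finite ?U" using N[OF x] D by auto
    have "card ?U \<le> (\<Sum>y\<in>?B. card {e \<in> E'. fst e = y \<or> snd e = y})" using N[OF x] by (intro card_UN_le) auto
    also have "\<dots> \<le> (\<Sum>y\<in>?B. D)" using D by (intro sum_mono) auto
    also have "\<dots> = card ?B * D" by simp
    also have "\<dots> \<le> N * D" using N[OF x] by (intro mult_right_mono) auto
    finally show ?thesis using finite_subset[OF sub fin] card_mono[OF fin sub] by linarith
  qed
  then show ?thesis using that by blast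
qed

text \<open>
  The two ends of an edge of the second graph are sent by \<open>g\<close> to vertices at distance at most \<open>k\<close>, so
  some edge of the first graph near \<open>g\<close> of the initial vertex controls the difference of \<open>u \<circ> g\<close>
  along it. The constant does not depend on \<open>u\<close>.
\<close>

lemma pullback_edge_diff:
  assumes p: "p > 1"
  obtains C where "C > 0" "\<And>u. u \<in> wk_functions p V E \<Longrightarrow> pullback u \<in> wk_functions p V' E' \<and>
    weak_lp_norm p E' (edge_diff E' (pullback u)) \<le> C * weak_lp_norm p E (edge_diff E u)"
proof -
  obtain N where N: "\<And>x. x \<in> V \<Longrightarrow> finite {e \<in> E'. (g (fst e), x) \<in> near E k} \<and>
    card {e \<in> E'. (g (fst e), x) \<in> near E k} \<le> N" using edge_preimage_of_ball by blast
  let ?R = "\<lambda>e' e. (g (fst e'), fst e) \<in> near E k"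
  have fib: "finite {i \<in> E'. ?R i j} \<and> card {i \<in> E'. ?R i j} \<le> N" if "j \<in> E" for j
    using N edges(1) that by auto
  have dom: "\<exists>e\<in>E. ?R e' e \<and> \<bar>edge_diff E' (pullback u) e'\<bar> \<le> real k * \<bar>edge_diff E u e\<bar>"
    if "e' \<in> E'" "edge_diff E' (pullback u) e' \<noteq> 0" for e' u
  proof -
    have V: "fst e' \<in> V'" "snd e' \<in> V'" using edges(2) that(1) by auto
    have "edge_diff E' (pullback u) e' = u (g (snd e')) - u (g (fst e'))"
      using V that(1) by (simp add: edge_diff_def pullback_def)
    moreover have "(g (fst e'), g (snd e')) \<in> near E k"
      using lipschitz(2) that(1) by (auto simp: coarse_lipschitz_def)
    ultimately show ?thesis using difference_bounded_by_edge that(2)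
      by (metis abs_minus_commute diff_self)
  qed
  have norm: "weak_lp_norm p E' (edge_diff E' (pullback u)) \<le> (real k * real N + 1) * weak_lp_norm p E (edge_diff E u)"
    if u: "u \<in> wk_functions p V E" for u
  proof -
    have du: "edge_diff E u \<in> weak_lp p E" using u by (simp add: wk_functions_iff)
    show ?thesis
      using weak_lp_norm_dominated[OF p du _ dom fib] weak_lp_norm_nonneg[OF p du]
      by (simp add: algebra_simps)
  qed
  have mem: "pullback u \<in> wk_functions p V' E'" if u: "u \<in> wk_functions p V E" for u
  proof -
    have du: "edge_diff E u \<in> weak_lp p E" using u by (simp add: wk_functions_iff)
    have "edge_diff E' (pullback u) \<in> weak_lp p E'"
      by (rule weak_lp_dominated[OF _ du _ _ dom fib]) (use p in \<open>auto intro: edge_diff_extensional\<close>)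
    then show ?thesis by (simp add: wk_functions_iff pullback_def)
  qed
  \<comment> \<open>The summand 1 makes the constant positive, so that one may divide by it.\<close>
  show ?thesis by (rule that[of "real k * real N + 1"]) (use norm mem in \<open>auto intro: add_nonneg_pos\<close>)
qed

text \<open>
  Composition with \<open>g\<close> preserves constants, and it preserves the weak Lebesgue space because the
  fibres of \<open>g\<close>, the preimages of balls of radius 0, have bounded cardinality.
\<close>

lemma pullback_null:
  assumes p: "p > 0" and n: "n \<in> wk_null p V"
  shows "pullback n \<in> wk_null p V'"
proof -
  obtain N where N: "\<And>x. x \<in> V \<Longrightarrow> finite {y \<in> V'. (g y, x) \<in> near E 0} \<and> card {y \<in> V'. (g y, x) \<in> near E 0} \<le> N"
    using preimage_of_ball by blast
  obtain c where s: "(\<lambda>x\<in>V. n x - c) \<in> weak_lp p V" using n by (auto simp: mem_wk_null)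
  have "(\<lambda>y\<in>V'. n (g y) - c) \<in> weak_lp p V'"
    by (rule weak_lp_dominated[OF p s, where K = 1 and R = "\<lambda>y x. (g y, x) \<in> near E 0" and N = N])
      (use N maps(2) in \<open>auto simp: near_0\<close>)
  then have "(\<lambda>y\<in>V'. pullback n y - c) \<in> weak_lp p V'" by (simp add: pullback_def cong: restrict_cong)
  then show ?thesis by (auto simp: mem_wk_null pullback_def)
qed

text \<open>
  Since \<open>g (f x)\<close> is near \<open>x\<close>, an edge near \<open>x\<close> controls the difference of the values of \<open>u\<close> there.
\<close>

lemma pullback_roundtrip:
  assumes p: "p > 0" and u: "u \<in> wk_functions p V E"
  shows "(\<lambda>x\<in>V. u (g (f x)) - u x) \<in> weak_lp p V"
proof -
  obtain N where N: "\<And>x. x \<in> V \<Longrightarrow> finite {y. (x, y) \<in> near E k} \<and> card {y. (x, y) \<in> near E k} \<le> N"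
    using bounded_balls[OF edges(1) degree(1)] by metis
  have du: "edge_diff E u \<in> weak_lp p E" using u by (simp add: wk_functions_iff)
  show ?thesis
  proof (rule weak_lp_dominated[OF p du, where K = "real k" and R = "\<lambda>x e. (x, fst e) \<in> near E k" and N = N])
    fix x assume x: "x \<in> V" "(\<lambda>x\<in>V. u (g (f x)) - u x) x \<noteq> 0"
    have "(x, g (f x)) \<in> near E k" using near_sym[OF inverse(1)[OF x(1)]] .
    then show "\<exists>e\<in>E. (x, fst e) \<in> near E k \<and> \<bar>(\<lambda>x\<in>V. u (g (f x)) - u x) x\<bar> \<le> real k * \<bar>edge_diff E u e\<bar>"
      using difference_bounded_by_edge[of x "g (f x)" E k u] x by (auto simp: abs_minus_commute)
  next
    fix e assume "e \<in> E"
    then have v: "fst e \<in> V" using edges(1) by auto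
    have "{x \<in> V. (x, fst e) \<in> near E k} \<subseteq> {y. (fst e, y) \<in> near E k}" by (auto dest: near_sym)
    then show "finite {x \<in> V. (x, fst e) \<in> near E k} \<and> card {x \<in> V. (x, fst e) \<in> near E k} \<le> N"
      using N[OF v] by (meson card_mono finite_subset order_trans)
  qed auto
qed

lemma pullback_class_class:
  assumes p: "p > 0" and u: "u \<in> extensional V"
  shows "pullback_class p (wk_class p V u) = wk_class p V' (pullback u)"
  unfolding pullback_class_def
proof (rule union_over_wk_class[OF u], rule wk_class_eq[OF p])
  fix w assume "w \<in> wk_class p V u"
  then have "(\<lambda>x\<in>V. w x - u x) \<in> wk_null p V" by (simp add: mem_wk_class)
  from pullback_null[OF p this] show "(\<lambda>y\<in>V'. pullback w y - pullback u y) \<in> wk_null p V'"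
    using maps(2) by (simp add: pullback_def Pi_iff cong: restrict_cong)
qed

lemma pullback_class_Wk:
  assumes p: "p > 1" and A: "A \<in> sn_carrier (Wk p V E)"
  obtains u where "u \<in> wk_functions p V E" "A = wk_class p V u" "pullback_class p A = wk_class p V' (pullback u)"
    "pullback u \<in> wk_functions p V' E'"
proof -
  obtain u where u: "u \<in> wk_functions p V E" "A = wk_class p V u" using A by (auto simp: Wk_def)
  moreover have "pullback u \<in> wk_functions p V' E'" using pullback_edge_diff[OF p] u by metis
  ultimately show ?thesis using that pullback_class_class p by (simp add: wk_functions_iff)
qed

lemma pullback_class_in:
  "p > 1 \<Longrightarrow> A \<in> sn_carrier (Wk p V E) \<Longrightarrow> pullback_class p A \<in> sn_carrier (Wk p V' E')"
  by (erule pullback_class_Wk, assumption) (auto simp: Wk_def)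

lemma pullback_class_add:
  assumes p: "p > 1" and A: "A \<in> sn_carrier (Wk p V E)" and B: "B \<in> sn_carrier (Wk p V E)"
  shows "pullback_class p (sn_add (Wk p V E) A B) = sn_add (Wk p V' E') (pullback_class p A) (pullback_class p B)"
proof -
  obtain u where u: "u \<in> wk_functions p V E" "A = wk_class p V u" "pullback_class p A = wk_class p V' (pullback u)"
    using pullback_class_Wk[OF p A] by blast
  obtain w where w: "w \<in> wk_functions p V E" "B = wk_class p V w" "pullback_class p B = wk_class p V' (pullback w)"
    using pullback_class_Wk[OF p B] by blast
  have "(\<lambda>v\<in>V'. pullback u v + pullback w v) = pullback (\<lambda>v\<in>V. u v + w v)"
    using maps(2) by (simp add: pullback_def Pi_iff cong: restrict_cong)
  then show ?thesis
    using u w p by (simp add: Wk_add_class wk_functions_iff pullback_class_class pullback_def)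
qed

lemma pullback_class_scale:
  assumes p: "p > 1" and A: "A \<in> sn_carrier (Wk p V E)"
  shows "pullback_class p (sn_scale (Wk p V E) c A) = sn_scale (Wk p V' E') c (pullback_class p A)"
proof -
  obtain u where u: "u \<in> wk_functions p V E" "A = wk_class p V u" "pullback_class p A = wk_class p V' (pullback u)"
    using pullback_class_Wk[OF p A] by blast
  have "(\<lambda>v\<in>V'. c * pullback u v) = pullback (\<lambda>v\<in>V. c * u v)"
    using maps(2) by (simp add: pullback_def Pi_iff cong: restrict_cong)
  then show ?thesis
    using u p by (simp add: Wk_scale_class wk_functions_iff pullback_class_class pullback_def)
qed

text \<open>
  Every representative \<open>w\<close> of \<open>A\<close> gives a representative \<open>w \<circ> g\<close> of the image, at the cost of a
  uniform constant; the infimum over all \<open>w\<close> transfers the bound to the quotient.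
\<close>

lemma pullback_class_norm:
  assumes p: "p > 1"
  shows "\<exists>C. \<forall>A\<in>sn_carrier (Wk p V E). sn_norm (Wk p V' E') (pullback_class p A) \<le> C * sn_norm (Wk p V E) A"
proof -
  obtain C where C: "C > 0" and bound: "\<And>u. u \<in> wk_functions p V E \<Longrightarrow> pullback u \<in> wk_functions p V' E' \<and>
    weak_lp_norm p E' (edge_diff E' (pullback u)) \<le> C * weak_lp_norm p E (edge_diff E u)"
    using pullback_edge_diff[OF p] by blast
  have "sn_norm (Wk p V' E') (pullback_class p A) \<le> C * sn_norm (Wk p V E) A"
    if A: "A \<in> sn_carrier (Wk p V E)" for A
  proof -
    obtain u where u: "u \<in> wk_functions p V E" "A = wk_class p V u" "pullback_class p A = wk_class p V' (pullback u)"
      using pullback_class_Wk[OF p A] by blast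
    let ?N = "\<lambda>A. {weak_lp_norm p E (edge_diff E w) | w. w \<in> A}"
    let ?N' = "\<lambda>A. {weak_lp_norm p E' (edge_diff E' w) | w. w \<in> A}"
    have wk: "w \<in> wk_functions p V E" if "w \<in> A" for w
      using wk_class_subset_wk_functions[OF edges(1) degree(1) _ u(1)] u(2) p that by auto
    have wk': "w \<in> wk_functions p V' E'" if "w \<in> pullback_class p A" for w
      using wk_class_subset_wk_functions[OF edges(2) degree(2)] bound[OF u(1)] u(3) p that by auto
    have bdd: "bdd_below (?N' (pullback_class p A))"
      using wk' weak_lp_norm_nonneg[OF p] by (intro bdd_belowI[of _ 0]) (auto simp: wk_functions_iff)
    have "Inf (?N' (pullback_class p A)) / C \<le> Inf (?N A)"
    proof (rule cInf_greatest)
      show "?N A \<noteq> {}" using wk_class_self[of u V p] u(1,2) by (auto simp: wk_functions_iff)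
      fix r assume "r \<in> ?N A"
      then obtain w where w: "w \<in> A" "r = weak_lp_norm p E (edge_diff E w)" by auto
      have "pullback w \<in> pullback_class p A"
        using w(1) wk_class_self[of "pullback w" V' p] by (auto simp: pullback_class_def pullback_def)
      then have "Inf (?N' (pullback_class p A)) \<le> weak_lp_norm p E' (edge_diff E' (pullback w))"
        by (intro cInf_lower bdd) auto
      also have "\<dots> \<le> C * r" using bound[OF wk[OF w(1)]] w(2) by simp
      finally show "Inf (?N' (pullback_class p A)) / C \<le> r" using C by (simp add: field_simps)
    qed
    then show ?thesis using C by (simp add: Wk_def field_simps)
  qed
  then show ?thesis by blast
qed

end

lemma pullback_class_inverse:
  assumes "coarse_inverses V E V' E' f g k" and p: "p > 1" and A: "A \<in> sn_carrier (Wk p V E)"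
  shows "coarse_inverses.pullback_class V f p (coarse_inverses.pullback_class V' g p A) = A"
proof -
  interpret fwd: coarse_inverses V E V' E' f g k by fact
  interpret bwd: coarse_inverses V' E' V E g f k by (rule fwd.swap)
  obtain u where u: "u \<in> wk_functions p V E" "A = wk_class p V u"
      "fwd.pullback_class p A = wk_class p V' (fwd.pullback u)" "fwd.pullback u \<in> wk_functions p V' E'"
    using fwd.pullback_class_Wk[OF p A] by blast
  have "bwd.pullback_class p (fwd.pullback_class p A) = wk_class p V (bwd.pullback (fwd.pullback u))"
    using u p by (simp add: bwd.pullback_class_class wk_functions_iff)
  also have "\<dots> = wk_class p V u"
  proof (rule wk_class_eq)
    have "(\<lambda>x\<in>V. u (g (f x)) - u x) \<in> wk_null p V"
      using fwd.pullback_roundtrip[OF _ u(1)] p by (intro weak_lp_subset_wk_null) auto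
    then show "(\<lambda>x\<in>V. bwd.pullback (fwd.pullback u) x - u x) \<in> wk_null p V"
      using fwd.maps(1) by (simp add: bwd.pullback_def fwd.pullback_def Pi_iff cong: restrict_cong)
  qed (use p in auto)
  finally show ?thesis using u by simp
qed

text \<open>
  The lower bound for the norm of the image is the upper bound for the inverse operator.
\<close>

lemma coarse_inverses_seminormed_isomorphic:
  assumes "coarse_inverses V E V' E' f g k" and p: "p > 1"
  shows "seminormed_isomorphic (Wk p V E) (Wk p V' E')"
proof -
  interpret fwd: coarse_inverses V E V' E' f g k by fact
  interpret bwd: coarse_inverses V' E' V E g f k by (rule fwd.swap)
  have inv: "bwd.pullback_class p (fwd.pullback_class p A) = A" if "A \<in> sn_carrier (Wk p V E)" for A
    by (rule pullback_class_inverse[OF assms that])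
  have inv': "fwd.pullback_class p (bwd.pullback_class p A) = A" if "A \<in> sn_carrier (Wk p V' E')" for A
    by (rule pullback_class_inverse[OF fwd.swap p that])
  have bij: "bij_betw (fwd.pullback_class p) (sn_carrier (Wk p V E)) (sn_carrier (Wk p V' E'))"
    by (rule bij_betw_byWitness[where f' = "bwd.pullback_class p"])
      (use inv inv' fwd.pullback_class_in[OF p] bwd.pullback_class_in[OF p] in auto)
  obtain C where "\<forall>B\<in>sn_carrier (Wk p V' E'). sn_norm (Wk p V E) (bwd.pullback_class p B) \<le> C * sn_norm (Wk p V' E') B"
    using bwd.pullback_class_norm[OF p] by blast
  then have "\<forall>A\<in>sn_carrier (Wk p V E). sn_norm (Wk p V E) A \<le> C * sn_norm (Wk p V' E') (fwd.pullback_class p A)"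
    using inv fwd.pullback_class_in[OF p] by metis
  then show ?thesis
    unfolding seminormed_isomorphic_def
    using bij fwd.pullback_class_add[OF p] fwd.pullback_class_scale[OF p] fwd.pullback_class_norm[OF p]
    by (intro exI[of _ "fwd.pullback_class p"]) blast
qed

theorem proposition3p1:
  fixes V :: "'v set" and E :: "('v \<times> 'v) set"
    and V' :: "'w set" and E' :: "('w \<times> 'w) set"
    and p :: real
  assumes "simplicial_graph V E" and "connected_graph V E" and "bounded_degree V E"
    and "simplicial_graph V' E'" and "connected_graph V' E'" and "bounded_degree V' E'"
    and "quasi_isometric (realization V E) (path_dist E) (realization V' E') (path_dist E')"
    and "p > 1"
  shows "seminormed_isomorphic (Wk p V E) (Wk p V' E')"
proof -
  have edges: "E \<subseteq> V \<times> V" "E' \<subseteq> V' \<times> V'" using assms(1,4) by (auto simp: simplicial_graph_def)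
  obtain f g k where "f \<in> V \<rightarrow> V'" "g \<in> V' \<rightarrow> V" "coarse_lipschitz E E' k f" "coarse_lipschitz E' E k g"
    "\<And>x. x \<in> V \<Longrightarrow> (g (f x), x) \<in> near E k" "\<And>y. y \<in> V' \<Longrightarrow> (f (g y), y) \<in> near E' k"
    using quasi_isometric_coarse_inverses[OF edges(1) assms(2) edges(2) assms(5,7)] by blast
  then have "coarse_inverses V E V' E' f g k"
    using edges assms(3,6) by unfold_locales auto
  then show ?thesis using assms(8) by (rule coarse_inverses_seminormed_isomorphic)
qed

end
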